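(* Let $d\ge 0$ and consider the Gaussian broadcast model on the finite model $P=\mathbb{Z}_{\ge 0}^{d+1}$ with parameters $\alpha_1,\dots,\alpha_{d+1}>0$. Then: (a) If there exists $i\in\{1,\dots,d+1\}$ such that $\alpha_i>1/i$, then convex reconstruction is possible. (b) If $\alpha_i\le 1/i$ for all $i\in\{1,\dots,d+1\}$, then reconstruction is not possible.
   Context: Gaussian broadcast model: Let $d\ge 0$ and let $P$ be an infinite graded poset with layers $L_0,L_1,\dots$ ($L_t$ = elements of rank $t$, $L_0$ = minimal elements), in which every element covers at most $d+1$ elements. For $v\in P$ let $\mathfrak p(v)$ be the set of elements covered by $v$ (so $\mathfrak p(v)=\emptyset$ iff $v\in L_0$). Given $\alpha_1,\dots,\alpha_{d+1}>0$, let $X_0\sim\mathcal N(0,1)$ and, independently, let $W_{u\to v}$ be i.i.d. $\mathcal N(0,1)$ indexed by covering pairs $u\lessdot v$. Set $X_v=X_0$ for $v\in L_0$, and for $v$ of rank $\ge1$ set $X_v=\alpha_{|\mathfrak p(v)|}\sum_{u\in\mathfrak p(v)}(X_u+W_{u\to v})$. Finite model: $P=\mathbb{Z}_{\ge0}^{d+1}$ with $u\le v$ iff $v-u\in\mathbb{Z}_{\ge0}^{d+1}$; $L_t$ is the set of tuples with coordinate sum $t$; $|\mathfrak p(v)|$ equals the number of positive coordinates of $v$; the unique minimal element is $\mathbf 0$. Reconstruction: reconstruction is possible if there is a function $c:P\to\mathbb R$, $u\mapsto c_u$, such that for every $t$ only finitely many $u\in L_t$ have $c_u\ne0$, and $\zeta_t:=\sum_{u\in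 L_t}c_uX_u$ satisfies $\operatorname{Var}(\zeta_t)>0$ for all $t\ge0$ and $\operatorname{corr}(\zeta_t,X_0)=\operatorname{Cov}(\zeta_t,X_0)/\sqrt{\operatorname{Var}(\zeta_t)\operatorname{Var}(X_0)}$ does not converge to $0$ as $t\to\infty$. Convex reconstruction is possible if moreover $c$ can be chosen with all values nonnegative. *)

theory Defs
  imports "HOL-Probability.Probability"
begin

definition layer :: "nat \<Rightarrow> nat \<Rightarrow> nat list set" where
  "layer d t = {v. length v = Suc d \<and> sum_list v = t}"

definition parents :: "nat \<Rightarrow> nat list \<Rightarrow> nat list set" where
  "parents d v = {v[i := v ! i - 1] | i. i < Suc d \<and> 0 < v ! i}"

definition covers :: "nat \<Rightarrow> (nat list \<times> nat list) set" where
  "covers d = {(u, v). length v = Suc d \<and> u \<in> parents d v}"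

text \<open>Broadcast values, defined by recursion on the rank t:
  Xr d t ... v is X_v for v of rank t.\<close>
primrec Xr :: "nat \<Rightarrow> nat \<Rightarrow> (nat \<Rightarrow> real) \<Rightarrow> ('a \<Rightarrow> real) \<Rightarrow>
    (nat list \<times> nat list \<Rightarrow> 'a \<Rightarrow> real) \<Rightarrow> nat list \<Rightarrow> 'a \<Rightarrow> real" where
  "Xr d 0 \<alpha> X0 W v = X0"
| "Xr d (Suc t) \<alpha> X0 W v = (\<lambda>\<omega>. \<alpha> (card (parents d v)) *
      (\<Sum>u\<in>parents d v. Xr d t \<alpha> X0 W u \<omega> + W (u, v) \<omega>))"

definition Xv :: "nat \<Rightarrow> (nat \<Rightarrow> real) \<Rightarrow> ('a \<Rightarrow> real) \<Rightarrow>
    (nat list \<times> nat list \<Rightarrow> 'a \<Rightarrow> real) \<Rightarrow> nat list \<Rightarrow> 'a \<Rightarrow> real" where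
  "Xv d \<alpha> X0 W v = Xr d (sum_list v) \<alpha> X0 W v"

definition covar :: "'a measure \<Rightarrow> ('a \<Rightarrow> real) \<Rightarrow> ('a \<Rightarrow> real) \<Rightarrow> real" where
  "covar M X Y = (\<integral>\<omega>. (X \<omega> - (\<integral>x. X x \<partial>M)) * (Y \<omega> - (\<integral>x. Y x \<partial>M)) \<partial>M)"

definition var :: "'a measure \<Rightarrow> ('a \<Rightarrow> real) \<Rightarrow> real" where
  "var M X = (\<integral>\<omega>. (X \<omega> - (\<integral>x. X x \<partial>M))\<^sup>2 \<partial>M)"

definition corr :: "'a measure \<Rightarrow> ('a \<Rightarrow> real) \<Rightarrow> ('a \<Rightarrow> real) \<Rightarrow> real" where
  "corr M X Y = covar M X Y / sqrt (var M X * var M Y)"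

definition zeta :: "nat \<Rightarrow> (nat \<Rightarrow> real) \<Rightarrow> ('a \<Rightarrow> real) \<Rightarrow>
    (nat list \<times> nat list \<Rightarrow> 'a \<Rightarrow> real) \<Rightarrow> (nat list \<Rightarrow> real) \<Rightarrow> nat \<Rightarrow> 'a \<Rightarrow> real" where
  "zeta d \<alpha> X0 W c t = (\<lambda>\<omega>. \<Sum>u\<in>{u \<in> layer d t. c u \<noteq> 0}. c u * Xv d \<alpha> X0 W u \<omega>)"

definition good_coeffs :: "'a measure \<Rightarrow> nat \<Rightarrow> (nat \<Rightarrow> real) \<Rightarrow> ('a \<Rightarrow> real) \<Rightarrow>
    (nat list \<times> nat list \<Rightarrow> 'a \<Rightarrow> real) \<Rightarrow> (nat list \<Rightarrow> real) \<Rightarrow> bool" where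
  "good_coeffs M d \<alpha> X0 W c \<longleftrightarrow>
     (\<forall>t. finite {u \<in> layer d t. c u \<noteq> 0}) \<and>
     (\<forall>t. var M (zeta d \<alpha> X0 W c t) > 0) \<and>
     \<not> ((\<lambda>t. corr M (zeta d \<alpha> X0 W c t) X0) \<longlonglongrightarrow> 0)"

definition reconstruction_possible :: "'a measure \<Rightarrow> nat \<Rightarrow> (nat \<Rightarrow> real) \<Rightarrow> ('a \<Rightarrow> real) \<Rightarrow>
    (nat list \<times> nat list \<Rightarrow> 'a \<Rightarrow> real) \<Rightarrow> bool" where
  "reconstruction_possible M d \<alpha> X0 W \<longleftrightarrow> (\<exists>c. good_coeffs M d \<alpha> X0 W c)"

definition convex_reconstruction_possible :: "'a measure \<Rightarrow> nat \<Rightarrow> (nat \<Rightarrow> real) \<Rightarrow> ('a \<Rightarrow> real) \<Rightarrow>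
    (nat list \<times> nat list \<Rightarrow> 'a \<Rightarrow> real) \<Rightarrow> bool" where
  "convex_reconstruction_possible M d \<alpha> X0 W \<longleftrightarrow>
     (\<exists>c. (\<forall>u. c u \<ge> 0) \<and> good_coeffs M d \<alpha> X0 W c)"

definition gaussian_broadcast :: "'a measure \<Rightarrow> nat \<Rightarrow> ('a \<Rightarrow> real) \<Rightarrow>
    (nat list \<times> nat list \<Rightarrow> 'a \<Rightarrow> real) \<Rightarrow> bool" where
  "gaussian_broadcast M d X0 W \<longleftrightarrow>
     prob_space M \<and>
     distributed M lborel X0 std_normal_density \<and>
     (\<forall>e\<in>covers d. distributed M lborel (W e) std_normal_density) \<and>
     prob_space.indep_vars M (\<lambda>_. borel)
        (\<lambda>i. case i of None \<Rightarrow> X0 | Some e \<Rightarrow> W e) (insert None (Some ` covers d))"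

end

theory Submission
  imports Defs "HOL-Real_Asymp.Real_Asymp"
begin

text \<open>Only second moments matter, and they are computed from the orthonormality of \<open>X0\<close> and the \<open>W e\<close>.

  (a) Let \<open>k\<close> be the least index with \<open>\<rho> = k \<alpha>\<^sub>k > 1\<close>. On the face spanned by the first \<open>k\<close>
  coordinates there are positive weights \<open>c\<close>, depending only on the number of positive coordinates,
  that form an eigenvector for passing to the previous layer:
  \<open>\<zeta>\<^sub>t\<^sub>+\<^sub>1 = \<rho> \<zeta>\<^sub>t + noise\<close>, where the new noise is orthogonal to \<open>\<zeta>\<^sub>t\<close> and has variance polynomial
  in \<open>t\<close>. So \<open>Var \<zeta>\<^sub>t\<close> and \<open>Cov(\<zeta>\<^sub>t, X0)\<^sup>2\<close> are both of order \<open>\<rho>\<^sup>2\<^sup>t\<close>.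

  (b) For a function \<open>q\<close> with \<open>q = 1\<close> at the origin, choose \<open>Y\<close> in the span of the \<open>W e\<close> such that
  \<open>Cov(X\<^sub>v, X0 + Y) = q v\<close> for all \<open>v\<close>; the cost \<open>Var Y\<close> is comparable to the sum of the squared
  defects \<open>q v - \<alpha> \<Sum> q u\<close> (sum over the \<open>u\<close> covered by \<open>v\<close>). If \<open>q\<close> vanishes on layer \<open>t\<close>, then
  \<open>Cov(\<zeta>\<^sub>t, X0) = - Cov(\<zeta>\<^sub>t, Y)\<close>, so the squared correlation is at most \<open>Var Y\<close>. It remains to find
  \<open>q\<close> of arbitrarily small cost vanishing on all large layers. This is done face dimension by face
  dimension: given \<open>q\<close> on the faces of dimension at most \<open>j\<close>, vanishing from rank \<open>T\<close> on, extend it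
  harmonically to the faces of dimension \<open>j + 1\<close> and multiply by a linear ramp of length \<open>n\<close> starting
  at rank \<open>T\<close>. The mass of the extension on a layer beyond \<open>T\<close> is at most some \<open>C\<close>
  independent of \<open>n\<close>, and its values lie in \<open>[0, 1]\<close>, so the ramp costs at most
  \<open>n \<cdot> C / n\<^sup>2 = C / n\<close>.\<close>

subsection \<open>Supports and the covering relation\<close>

text \<open>Equals the number of elements covered by \<open>v\<close> and is the dimension of the
  smallest coordinate face containing \<open>v\<close>; the weights in part (a) and the induction in
  part (b) are organised by it.\<close>

definition supp_size :: "nat list \<Rightarrow> nat" where
  "supp_size v = card {i. i < length v \<and> 0 < v ! i}"

abbreviation incr :: "nat list \<Rightarrow> nat \<Rightarrow> nat list" where
  "incr u i \<equiv> u[i := Suc (u ! i)]"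

lemma supp_size_le: "length v = Suc d \<Longrightarrow> supp_size v \<le> Suc d"
  using card_mono[of "{..<Suc d}" "{i. i < length v \<and> 0 < v ! i}"]
  by (auto simp: supp_size_def)

lemma parents_eq_image:
  "parents d v = (\<lambda>i. v[i := v ! i - 1]) ` {i. i < Suc d \<and> 0 < v ! i}"
  by (auto simp: parents_def)

lemma finite_parents [simp]: "finite (parents d v)"
  by (simp add: parents_eq_image)

lemma inj_on_decr:
  fixes v :: "nat list"
  assumes "length v = Suc d"
  shows "inj_on (\<lambda>i. v[i := v ! i - 1]) {i. i < Suc d \<and> 0 < v ! i}"
proof (rule inj_onI)
  fix i j assume i: "i \<in> {i. i < Suc d \<and> 0 < v ! i}" and j: "j \<in> {i. i < Suc d \<and> 0 < v ! i}"
    and eq: "v[i := v ! i - 1] = v[j := v ! j - 1]"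
  have "v[i := v ! i - 1] ! i = v[j := v ! j - 1] ! i" using eq by simp
  then have "i \<noteq> j \<Longrightarrow> v ! i - 1 = v ! i" using i assms by simp
  moreover have "v ! i - 1 \<noteq> v ! i" using i by (cases "v ! i") auto
  ultimately show "i = j" by blast
qed

lemma card_parents: "length v = Suc d \<Longrightarrow> card (parents d v) = supp_size v"
  by (simp only: parents_eq_image card_image[OF inj_on_decr] supp_size_def)

lemma finite_layer [simp]: "finite (layer d t)"
proof (rule finite_subset)
  show "layer d t \<subseteq> {xs. set xs \<subseteq> {..t} \<and> length xs = Suc d}"
    by (auto simp: layer_def dest: member_le_sum_list)
  show "finite {xs. set xs \<subseteq> {..t} \<and> length xs = Suc d}"
    by (rule finite_lists_length_eq) simp
qed

lemma card_layer_le: "card (layer d t) \<le> Suc t ^ Suc d"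
proof -
  have "card (layer d t) \<le> card {xs. set xs \<subseteq> {..t} \<and> length xs = Suc d}"
    by (rule card_mono[OF finite_lists_length_eq])
      (auto simp: layer_def dest: member_le_sum_list)
  also have "\<dots> = Suc t ^ Suc d"
    by (subst card_lists_length_eq) auto
  finally show ?thesis .
qed

lemma layer_length: "v \<in> layer d t \<Longrightarrow> length v = Suc d"
  by (simp add: layer_def)

lemma layer_0: "layer d 0 = {replicate (Suc d) 0}"
  by (auto simp: layer_def sum_list_eq_0_iff intro!: replicate_eqI simp del: replicate_Suc)

lemma parents_layer:
  assumes "v \<in> layer d (Suc t)" "u \<in> parents d v" shows "u \<in> layer d t"
proof -
  obtain i where i: "i < Suc d" "0 < v ! i" "u = v[i := v ! i - 1]"
    using assms(2) by (auto simp: parents_def)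
  have "v ! i \<le> sum_list v" by (rule elem_le_sum_list) (use i assms in \<open>simp add: layer_def\<close>)
  then show ?thesis using i assms
    by (auto simp: layer_def sum_list_update)
qed

lemma incr_layer: "u \<in> layer d t \<Longrightarrow> i < Suc d \<Longrightarrow> incr u i \<in> layer d (Suc t)"
  by (auto simp: layer_def sum_list_update elem_le_sum_list)

lemma supp_size_incr:
  assumes "length u = Suc d" "i < Suc d"
  shows "supp_size (incr u i) = (if 0 < u ! i then supp_size u else Suc (supp_size u))"
proof -
  let ?S = "{j. j < Suc d \<and> 0 < u ! j}"
  have "{j. j < Suc d \<and> 0 < incr u i ! j} = insert i ?S"
    using assms by (auto simp: nth_list_update)
  then show ?thesis using assms by (auto simp: supp_size_def insert_absorb card_insert_if)
qed

lemma supp_size_parent: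
  assumes "v \<in> layer d (Suc t)" "u \<in> parents d v"
  shows "supp_size u \<le> supp_size v"
proof -
  have l: "length v = Suc d" using assms by (simp add: layer_def)
  obtain i where i: "i < Suc d" "0 < v ! i" "u = v[i := v ! i - 1]"
    using assms(2) by (auto simp: parents_def)
  have "incr u i = v" "length u = Suc d" using i l by auto
  then show ?thesis using supp_size_incr[of u d i] i by (auto split: if_splits)
qed

lemma supp_size_pos:
  assumes "v \<in> layer d (Suc t)" shows "0 < supp_size v"
proof (rule ccontr)
  assume "\<not> 0 < supp_size v"
  then have "\<forall>i<Suc d. v ! i = 0" using assms by (auto simp: supp_size_def layer_def)
  then have "sum_list v = 0" using assms
    unfolding sum_list_sum_nth by (intro sum.neutral) (auto simp: layer_def)
  moreover have "sum_list v = Suc t" using assms by (simp add: layer_def)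
  ultimately show False by linarith
qed

text \<open>Double counting of covering pairs: seen from above, a pair is a positive coordinate of
  \<open>v\<close> to lower; seen from below, it is any of the \<open>Suc d\<close> coordinates of
  \<open>u\<close> to raise.\<close>

lemma sum_layer_Suc_parents:
  fixes F :: "nat list \<Rightarrow> nat list \<Rightarrow> 'b::comm_monoid_add"
  shows "(\<Sum>v\<in>layer d (Suc t). \<Sum>u\<in>parents d v. F u v) =
    (\<Sum>u\<in>layer d t. \<Sum>i<Suc d. F u (incr u i))"
proof -
  have "(\<Sum>v\<in>layer d (Suc t). \<Sum>u\<in>parents d v. F u v) =
      (\<Sum>v\<in>layer d (Suc t). \<Sum>i\<in>{i. i < Suc d \<and> 0 < v ! i}. F (v[i := v ! i - 1]) v)"
  proof (rule sum.cong[OF refl])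
    fix v assume "v \<in> layer d (Suc t)"
    then show "(\<Sum>u\<in>parents d v. F u v) =
        (\<Sum>i\<in>{i. i < Suc d \<and> 0 < v ! i}. F (v[i := v ! i - 1]) v)"
      unfolding parents_eq_image by (subst sum.reindex[OF inj_on_decr[OF layer_length]]) auto
  qed
  also have "\<dots> = (\<Sum>(v, i)\<in>(SIGMA v:layer d (Suc t). {i. i < Suc d \<and> 0 < v ! i}).
      F (v[i := v ! i - 1]) v)"
    by (rule sum.Sigma) auto
  also have "\<dots> = (\<Sum>(u, i)\<in>layer d t \<times> {..<Suc d}. F u (incr u i))"
  proof (rule sum.reindex_bij_witness[where i = "\<lambda>(u, i). (incr u i, i)"
        and j = "\<lambda>(v, i). (v[i := v ! i - 1], i)"])
    fix a assume a: "a \<in> (SIGMA v:layer d (Suc t). {i. i < Suc d \<and> 0 < v ! i})"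
    obtain v i where vi: "a = (v, i)" "v \<in> layer d (Suc t)" "i < Suc d" "0 < v ! i"
      using a by auto
    moreover have "length v = Suc d" using vi layer_length by blast
    moreover have "v[i := v ! i - 1] \<in> layer d t"
      using vi by (intro parents_layer[OF vi(2)]) (auto simp: parents_def)
    ultimately show
      "(case case a of (v, i) \<Rightarrow> (v[i := v ! i - 1], i) of (u, i) \<Rightarrow> (incr u i, i)) = a"
      "(case a of (v, i) \<Rightarrow> (v[i := v ! i - 1], i)) \<in> layer d t \<times> {..<Suc d}"
      "(case case a of (v, i) \<Rightarrow> (v[i := v ! i - 1], i) of (u, i) \<Rightarrow> F u (incr u i)) =
       (case a of (v, i) \<Rightarrow> F (v[i := v ! i - 1]) v)"
      by auto
  next
    fix b assume b: "b \<in> layer d t \<times> {..<Suc d}"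
    obtain u i where ui: "b = (u, i)" "u \<in> layer d t" "i < Suc d"
      using b by auto
    moreover have "length u = Suc d" using ui layer_length by blast
    moreover have "incr u i \<in> layer d (Suc t)" using ui by (intro incr_layer)
    ultimately show
      "(case case b of (u, i) \<Rightarrow> (incr u i, i) of (v, i) \<Rightarrow> (v[i := v ! i - 1], i)) = b"
      "(case b of (u, i) \<Rightarrow> (incr u i, i)) \<in> (SIGMA v:layer d (Suc t). {i. i < Suc d \<and> 0 < v ! i})"
      by auto
  qed
  also have "\<dots> = (\<Sum>u\<in>layer d t. \<Sum>i<Suc d. F u (incr u i))"
    by (rule sum.Sigma[symmetric]) auto
  finally show ?thesis .
qed

subsection \<open>Centered square-integrable functions\<close>

text \<open>Mean zero is built in so that \<open>var\<close> and \<open>covar\<close> reduce to the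
  bilinear form \<open>ip\<close>.\<close>

definition centered_L2 :: "'a measure \<Rightarrow> ('a \<Rightarrow> real) \<Rightarrow> bool" where
  "centered_L2 M f \<longleftrightarrow> integrable M f \<and> integrable M (\<lambda>x. (f x)\<^sup>2) \<and> (\<integral>x. f x \<partial>M) = 0"

lemma integrable_mult_L2:
  assumes "centered_L2 M f" "centered_L2 M g"
  shows "integrable M (\<lambda>x. f x * g x)"
proof (rule Bochner_Integration.integrable_bound[where f = "\<lambda>x. (f x)\<^sup>2 + (g x)\<^sup>2"])
  show "AE x in M. norm (f x * g x) \<le> norm ((f x)\<^sup>2 + (g x)\<^sup>2)"
  proof (intro AE_I2)
    fix x show "norm (f x * g x) \<le> norm ((f x)\<^sup>2 + (g x)\<^sup>2)"
      using sum_squares_bound[of "\<bar>f x\<bar>" "\<bar>g x\<bar>"] mult_nonneg_nonneg[of "\<bar>f x\<bar>" "\<bar>g x\<bar>"]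
      unfolding real_norm_def abs_mult power2_abs by linarith
  qed
qed (use assms in \<open>auto simp: centered_L2_def\<close>)

lemma centered_L2_zero [simp]: "centered_L2 M (\<lambda>x. 0)"
  by (simp add: centered_L2_def)

lemma centered_L2_cmult: "centered_L2 M f \<Longrightarrow> centered_L2 M (\<lambda>x. a * f x)"
  by (simp add: centered_L2_def power_mult_distrib)

lemma centered_L2_add:
  assumes "centered_L2 M f" "centered_L2 M g"
  shows "centered_L2 M (\<lambda>x. f x + g x)"
proof -
  have "integrable M (\<lambda>x. (f x)\<^sup>2 + 2 * (f x * g x) + (g x)\<^sup>2)"
    using integrable_mult_L2[OF assms] assms by (auto simp: centered_L2_def)
  then show ?thesis using assms
    by (auto simp: centered_L2_def power2_sum algebra_simps)
qed

lemma centered_L2_sum: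
  "(\<And>i. i \<in> I \<Longrightarrow> centered_L2 M (f i)) \<Longrightarrow> centered_L2 M (\<lambda>x. \<Sum>i\<in>I. f i x)"
  by (induction I rule: infinite_finite_induct) (auto intro: centered_L2_add)

section \<open>Covariance as an inner product\<close>

definition ip :: "'a measure \<Rightarrow> ('a \<Rightarrow> real) \<Rightarrow> ('a \<Rightarrow> real) \<Rightarrow> real" where
  "ip M f g = (\<integral>x. f x * g x \<partial>M)"

lemma ip_commute: "ip M f g = ip M g f"
  by (simp add: ip_def mult.commute)

lemma ip_add_left:
  "centered_L2 M f \<Longrightarrow> centered_L2 M g \<Longrightarrow> centered_L2 M h \<Longrightarrow>
    ip M (\<lambda>x. f x + g x) h = ip M f h + ip M g h"
  by (simp add: ip_def distrib_right integrable_mult_L2)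

lemma ip_cmult_left: "ip M (\<lambda>x. a * f x) h = a * ip M f h"
  by (simp add: ip_def mult.assoc)

lemma ip_sum_left:
  assumes "\<And>i. i \<in> I \<Longrightarrow> centered_L2 M (f i)" "centered_L2 M h"
  shows "ip M (\<lambda>x. \<Sum>i\<in>I. f i x) h = (\<Sum>i\<in>I. ip M (f i) h)"
  using assms by (simp add: ip_def sum_distrib_right integrable_mult_L2)

lemma ip_add_right:
  "centered_L2 M f \<Longrightarrow> centered_L2 M g \<Longrightarrow> centered_L2 M h \<Longrightarrow>
    ip M h (\<lambda>x. f x + g x) = ip M h f + ip M h g"
  using ip_add_left[of M f g h] by (simp add: ip_commute)

lemma ip_cmult_right: "ip M h (\<lambda>x. a * f x) = a * ip M h f"
  using ip_cmult_left[of M a f h] by (simp add: ip_commute)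

lemma ip_sum_right:
  assumes "\<And>i. i \<in> I \<Longrightarrow> centered_L2 M (f i)" "centered_L2 M h"
  shows "ip M h (\<lambda>x. \<Sum>i\<in>I. f i x) = (\<Sum>i\<in>I. ip M h (f i))"
  using ip_sum_left[of I M f h] assms by (simp add: ip_commute)

lemma ip_nonneg: "0 \<le> ip M f f"
  by (simp add: ip_def)

lemma ip_Cauchy_Schwarz:
  assumes f: "centered_L2 M f" and g: "centered_L2 M g"
  shows "(ip M f g)\<^sup>2 \<le> ip M f f * ip M g g"
proof -
  let ?a = "ip M f f" and ?b = "ip M f g" and ?c = "ip M g g"
  have quad: "0 \<le> ?a + 2 * s * ?b + s\<^sup>2 * ?c" for s
  proof -
    have s: "centered_L2 M (\<lambda>x. s * g x)" by (rule centered_L2_cmult[OF g])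
    have "0 \<le> ip M (\<lambda>x. f x + s * g x) (\<lambda>x. f x + s * g x)" by (rule ip_nonneg)
    also have "\<dots> = ?a + 2 * s * ?b + s\<^sup>2 * ?c"
      using ip_commute[of M g f]
      by (simp add: ip_add_left[OF f s centered_L2_add[OF f s]] ip_cmult_left ip_cmult_right
          ip_add_right[OF f s f] ip_add_right[OF f s g] power2_eq_square algebra_simps)
    finally show ?thesis .
  qed
  show ?thesis
  proof (cases "?c = 0")
    case True
    have "?b = 0"
    proof (rule ccontr)
      assume "?b \<noteq> 0"
      \<comment> \<open>With \<open>?c = 0\<close> this value of \<open>s\<close> makes the
        quadratic equal to -1.\<close>
      then show False using quad[of "- (?a + 1) / (2 * ?b)"] True by (simp add: field_simps)
    qed
    then show ?thesis by (simp add: True)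
  next
    case False
    then have c: "?c > 0" using ip_nonneg[of M g] by simp
    \<comment> \<open>The value \<open>s = - ?b / ?c\<close> minimises the quadratic.\<close>
    have "0 \<le> ?c * (?a + 2 * (- ?b / ?c) * ?b + (- ?b / ?c)\<^sup>2 * ?c)"
      using quad[of "- ?b / ?c"] c by (intro mult_nonneg_nonneg) (rule less_imp_le)
    also have "\<dots> = ?a * ?c - ?b\<^sup>2"
      using c by (simp add: field_simps power2_eq_square)
    finally show ?thesis by simp
  qed
qed

section \<open>Second moments of Gaussian and independent variables\<close>

lemma (in prob_space) std_normal_centered_L2:
  assumes D: "distributed M lborel X std_normal_density"
  shows "centered_L2 M X" "ip M X X = 1"
proof -
  have 1: "integrable M X"
    using integrable_std_normal_moment[of 1] distributed_integrable[OF D, of "\<lambda>x. x"] by simp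
  have 2: "integrable M (\<lambda>x. (X x)\<^sup>2)"
    using integrable_std_normal_moment[of 2] distributed_integrable[OF D, of "\<lambda>x. x\<^sup>2"] by simp
  have 3: "expectation X = 0" by (rule standard_normal_distributed_expectation[OF D])
  show "centered_L2 M X" using 1 2 3 by (simp add: centered_L2_def)
  show "ip M X X = 1" using standard_normal_distributed_variance[OF D] 3
    by (simp add: ip_def power2_eq_square)
qed

lemma (in prob_space) indep_vars_ip_eq_0:
  assumes "indep_vars (\<lambda>_. borel) X I" "i \<in> I" "j \<in> I" "i \<noteq> j"
    and "centered_L2 M (X i)" "centered_L2 M (X j)"
  shows "ip M (X i) (X j) = 0"
proof -
  have "indep_vars (\<lambda>_. borel) X (insert i {j})"
    using assms by (intro indep_vars_subset[OF assms(1)]) auto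
  \<comment> \<open>\<open>indep_vars_sum\<close> makes \<open>X i\<close> independent of the sum
    over \<open>{j}\<close>, which is \<open>X j\<close> alone.\<close>
  from indep_vars_sum[OF _ _ this] assms have "indep_var borel (X i) borel (X j)" by simp
  from indep_var_lebesgue_integral[OF this] assms show ?thesis
    by (simp add: ip_def centered_L2_def)
qed

subsection \<open>Functions of small defect vanishing far from the minimal element\<close>

text \<open>If \<open>q v\<close> is to be the covariance of \<open>X_v\<close> with some variable,
  the recursion for \<open>X_v\<close> leaves exactly this amount to be supplied by the edge sources
  \<open>W (u, v)\<close>.\<close>

definition defect :: "nat \<Rightarrow> (nat \<Rightarrow> real) \<Rightarrow> (nat list \<Rightarrow> real) \<Rightarrow> nat list \<Rightarrow> real" where
  "defect d \<alpha> q v = q v - \<alpha> (supp_size v) * (\<Sum>u\<in>parents d v. q u)"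

text \<open>A Dirichlet problem solved layer by layer: boundary data \<open>q\<close> on faces of
  dimension at most \<open>j\<close>, zero \<open>defect\<close> on the others. The rank is a
  separate argument as in \<open>Xr\<close>, so the value is meant for \<open>v\<close> of rank
  \<open>t\<close>.\<close>

primrec harm_ext :: "nat \<Rightarrow> (nat \<Rightarrow> real) \<Rightarrow> nat \<Rightarrow> (nat list \<Rightarrow> real) \<Rightarrow> nat \<Rightarrow> nat list \<Rightarrow> real"
  where
  "harm_ext d \<alpha> j q 0 v = q v"
| "harm_ext d \<alpha> j q (Suc t) v = (if supp_size v \<le> j then q v
     else \<alpha> (supp_size v) * (\<Sum>u\<in>parents d v. harm_ext d \<alpha> j q t u))"

lemma harm_ext_boundary: "supp_size v \<le> j \<Longrightarrow> harm_ext d \<alpha> j q t v = q v"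
  by (cases t) auto

text \<open>Maximum principle: since \<open>\<alpha> i * real i \<le> 1\<close>, an extended value
  is at most the average of the values at the covered elements.\<close>

lemma harm_ext_bounds:
  assumes \<alpha>: "\<And>i. i \<in> {1..Suc d} \<Longrightarrow> 0 < \<alpha> i \<and> \<alpha> i * real i \<le> 1"
    and q: "\<And>t v. v \<in> layer d t \<Longrightarrow> 0 \<le> q v \<and> q v \<le> (1::real)"
    and v: "v \<in> layer d t"
  shows "0 \<le> harm_ext d \<alpha> j q t v \<and> harm_ext d \<alpha> j q t v \<le> 1"
  using v
proof (induction t arbitrary: v)
  case 0
  then show ?case using q by simp
next
  case (Suc t)
  have IH: "0 \<le> harm_ext d \<alpha> j q t u" "harm_ext d \<alpha> j q t u \<le> 1" if "u \<in> parents d v" for u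
    using Suc.IH[OF parents_layer[OF Suc.prems that]] by auto
  have l: "length v = Suc d" using Suc.prems by (rule layer_length)
  have "supp_size v \<in> {1..Suc d}"
    using supp_size_pos[OF Suc.prems] supp_size_le[OF l] by simp
  note a = \<alpha>[OF this]
  have "(\<Sum>u\<in>parents d v. harm_ext d \<alpha> j q t u) \<le> real (supp_size v)"
    using sum_bounded_above[of "parents d v" "harm_ext d \<alpha> j q t" 1] IH card_parents[OF l] by simp
  then have "\<alpha> (supp_size v) * (\<Sum>u\<in>parents d v. harm_ext d \<alpha> j q t u)
      \<le> \<alpha> (supp_size v) * real (supp_size v)"
    using a by (intro mult_left_mono) auto
  with a have "\<alpha> (supp_size v) * (\<Sum>u\<in>parents d v. harm_ext d \<alpha> j q t u) \<le> 1" by linarith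
  moreover have "0 \<le> \<alpha> (supp_size v) * (\<Sum>u\<in>parents d v. harm_ext d \<alpha> j q t u)"
    using a IH by (intro mult_nonneg_nonneg sum_nonneg) auto
  ultimately show ?case using q[OF Suc.prems] by simp
qed

text \<open>Every element with support of size \<open>Suc j\<close> has exactly \<open>Suc j\<close> upper covers with support
  of the same size; as \<open>\<alpha> (Suc j) * Suc j \<le> 1\<close>, mass carried by such elements cannot grow once the
  boundary values vanish.\<close>

lemma harm_ext_mass_le:
  assumes \<alpha>: "\<And>i. i \<in> {1..Suc d} \<Longrightarrow> 0 < \<alpha> i \<and> \<alpha> i * real i \<le> 1"
    and q: "\<And>t v. v \<in> layer d t \<Longrightarrow> 0 \<le> q v \<and> q v \<le> (1::real)"
    and q0: "\<And>t v. T \<le> t \<Longrightarrow> v \<in> layer d t \<Longrightarrow> supp_size v \<le> j \<Longrightarrow> q v = 0"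
    and t: "T \<le> t"
  shows "(\<Sum>v\<in>layer d t. of_bool (supp_size v = Suc j) * harm_ext d \<alpha> j q t v)
    \<le> real (card (layer d T))"
  using t
proof (induction t rule: dec_induct)
  case base
  have "of_bool (supp_size v = Suc j) * harm_ext d \<alpha> j q T v \<le> 1" if "v \<in> layer d T" for v
    using harm_ext_bounds[OF \<alpha> q that, where j = j] by auto
  then show ?case
    using sum_bounded_above[of "layer d T"
        "\<lambda>v. of_bool (supp_size v = Suc j) * harm_ext d \<alpha> j q T v" 1] by simp
next
  case (step t)
  let ?h = "harm_ext d \<alpha> j q t"
  \<comment> \<open>Inserting the indicator of \<open>u\<close> changes nothing: a parent with
    smaller support lies where \<open>q0\<close> makes the extension vanish. It restricts the count
    below to covers that keep the support size.\<close>
  define F where "F u v = of_bool (supp_size v = Suc j) * of_bool (supp_size u = Suc j)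
      * (\<alpha> (Suc j) * ?h u)" for u v
  have "(\<Sum>v\<in>layer d (Suc t). of_bool (supp_size v = Suc j) * harm_ext d \<alpha> j q (Suc t) v)
      = (\<Sum>v\<in>layer d (Suc t). \<Sum>u\<in>parents d v. F u v)"
  proof (intro sum.cong refl)
    fix v assume v: "v \<in> layer d (Suc t)"
    have "?h u = of_bool (supp_size u = Suc j) * ?h u"
      if u: "u \<in> parents d v" and s: "supp_size v = Suc j" for u
    proof (cases "supp_size u = Suc j")
      case False
      then have "supp_size u \<le> j" using supp_size_parent[OF v u] s by simp
      then show ?thesis using q0[OF step(1) parents_layer[OF v u]] by (simp add: harm_ext_boundary)
    qed simp
    then have "\<alpha> (Suc j) * ?h u = F u v" if "u \<in> parents d v" "supp_size v = Suc j" for u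
      using that by (auto simp: F_def)
    then have "supp_size v = Suc j \<Longrightarrow>
        (\<Sum>u\<in>parents d v. \<alpha> (Suc j) * ?h u) = (\<Sum>u\<in>parents d v. F u v)"
      by (intro sum.cong refl)
    then show "of_bool (supp_size v = Suc j) * harm_ext d \<alpha> j q (Suc t) v = (\<Sum>u\<in>parents d v. F u v)"
      by (cases "supp_size v = Suc j") (simp_all add: F_def[of _ v] sum_distrib_left)
  qed
  also have "\<dots> = (\<Sum>u\<in>layer d t. \<Sum>i<Suc d. F u (incr u i))"
    by (rule sum_layer_Suc_parents)
  also have "\<dots> \<le> (\<Sum>u\<in>layer d t. of_bool (supp_size u = Suc j) * ?h u)"
  proof (rule sum_mono)
    fix u assume u: "u \<in> layer d t"
    show "(\<Sum>i<Suc d. F u (incr u i)) \<le> of_bool (supp_size u = Suc j) * ?h u"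
    proof (cases "supp_size u = Suc j")
      case True
      have l: "length u = Suc d" using u by (rule layer_length)
      have "(\<Sum>i<Suc d. F u (incr u i)) =
          (\<Sum>i<Suc d. of_bool (0 < u ! i) * (\<alpha> (Suc j) * ?h u))"
        by (intro sum.cong refl) (auto simp: F_def supp_size_incr[OF l] True)
      also have "\<dots> = real (card ({..<Suc d} \<inter> {i. 0 < u ! i})) * (\<alpha> (Suc j) * ?h u)"
        by (simp only: sum_distrib_right[symmetric] sum_of_bool_eq finite_lessThan)
      also have "{..<Suc d} \<inter> {i. 0 < u ! i} = {i. i < length u \<and> 0 < u ! i}"
        using l by auto
      also have "real (card \<dots>) * (\<alpha> (Suc j) * ?h u) = (\<alpha> (Suc j) * real (Suc j)) * ?h u"
        using True by (simp add: supp_size_def)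
      also have "\<dots> \<le> 1 * ?h u"
        using \<alpha>[of "Suc j"] supp_size_le[OF l] True harm_ext_bounds[OF \<alpha> q u, where j = j]
        by (intro mult_right_mono) auto
      finally show ?thesis using True by simp
    qed (simp add: F_def)
  qed
  also have "\<dots> \<le> real (card (layer d T))" by (rule step.IH)
  finally show ?case .
qed

text \<open>On supports of size at most \<open>j\<close> nothing changes, since the ramp acts only
  where \<open>q\<close> is already zero there. On supports of size \<open>Suc j\<close> only the
  \<open>n\<close> ramp layers cost anything, and their masses are bounded by
  \<open>card (layer d T)\<close> whatever \<open>n\<close> is.\<close>

lemma small_defect_step:
  fixes \<alpha> :: "nat \<Rightarrow> real"
  assumes \<alpha>: "\<And>i. i \<in> {1..Suc d} \<Longrightarrow> 0 < \<alpha> i \<and> \<alpha> i * real i \<le> 1"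
    and q: "\<And>t v. v \<in> layer d t \<Longrightarrow> 0 \<le> q v \<and> q v \<le> 1"
    and q1: "\<And>v. v \<in> layer d 0 \<Longrightarrow> q v = 1"
    and q0: "\<And>t v. T \<le> t \<Longrightarrow> v \<in> layer d t \<Longrightarrow> supp_size v \<le> j \<Longrightarrow> q v = 0"
    and n: "0 < n"
  obtains q' where "\<And>t v. v \<in> layer d t \<Longrightarrow> 0 \<le> q' v \<and> q' v \<le> (1::real)"
    "\<And>v. v \<in> layer d 0 \<Longrightarrow> q' v = 1"
    "\<And>t v. T + n \<le> t \<Longrightarrow> v \<in> layer d t \<Longrightarrow> supp_size v \<le> Suc j \<Longrightarrow> q' v = 0"
    "\<And>N. (\<Sum>t<N. \<Sum>v\<in>{v \<in> layer d (Suc t). supp_size v \<le> Suc j}. (defect d \<alpha> q' v)\<^sup>2)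
      \<le> (\<Sum>t<N. \<Sum>v\<in>{v \<in> layer d (Suc t). supp_size v \<le> j}. (defect d \<alpha> q v)\<^sup>2)
        + real (card (layer d T)) / real n"
proof -
  \<comment> \<open>Truncated subtraction gives both plateaus: 1 up to rank \<open>T\<close>, 0 from
    rank \<open>T + n\<close> on.\<close>
  define r where "r t = real (n - (t - T)) / real n" for t
  define p where "p v = harm_ext d \<alpha> j q (sum_list v) v" for v
  define q' where "q' v = p v * r (sum_list v)" for v
  let ?C = "real (card (layer d T))"
  have p_layer: "p v = harm_ext d \<alpha> j q t v" "q' v = p v * r t" if "v \<in> layer d t" for v t
    using that by (simp_all add: p_def q'_def layer_def)
  have p_eq: "p v = q v" if "supp_size v \<le> j" for v
    using that by (simp add: p_def harm_ext_boundary)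
  have p_bounds: "0 \<le> p v" "p v \<le> 1" if "v \<in> layer d t" for v t
    using harm_ext_bounds[OF \<alpha> q that, where j = j] p_layer[OF that] by auto
  have r: "0 \<le> r t" "r t \<le> 1" for t using n by (auto simp: r_def)
  have r1: "r t = 1" if "t \<le> T" for t using n that by (simp add: r_def)
  have r0: "r t = 0" if "T + n \<le> t" for t using n that by (simp add: r_def)
  have r_diff: "(r (Suc t) - r t)\<^sup>2 = of_bool (t \<in> {T..<T + n}) * (1 / (real n)\<^sup>2)" for t
  proof (cases "t \<in> {T..<T + n}")
    case True
    then have "n - (t - T) = Suc (n - (Suc t - T))" by auto
    then have "r t = (real (n - (Suc t - T)) + 1) / real n" by (simp add: r_def)
    then have "r (Suc t) - r t = - (1 / real n)"
      using n by (simp add: r_def diff_divide_distrib[symmetric])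
    then show ?thesis using True by (simp add: power_divide)
  next
    case False
    then have "r (Suc t) = r t" using r1[of t] r1[of "Suc t"] r0[of t] r0[of "Suc t"]
      by (cases "t < T") auto
    then show ?thesis using False by simp
  qed
  \<comment> \<open>Up to rank \<open>T\<close> the ramp is 1; from rank \<open>T\<close> on both
    sides are 0.\<close>
  have q'_eq: "q' v = q v" if "v \<in> layer d t" "supp_size v \<le> j" for v t
    using that p_layer(2)[OF that(1)] p_eq[OF that(2)] r1[of t] q0[of t v] by (cases "t \<le> T") auto
  have defect_old: "defect d \<alpha> q' v = defect d \<alpha> q v"
    if v: "v \<in> layer d (Suc t)" and s: "supp_size v \<le> j" for v t
  proof -
    have "q' u = q u" if "u \<in> parents d v" for u
      using supp_size_parent[OF v that] s by (intro q'_eq[OF parents_layer[OF v that]]) simp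
    then show ?thesis using q'_eq[OF v s] by (simp add: defect_def)
  qed
  \<comment> \<open>\<open>p\<close> is harmonic at \<open>v\<close> and all parents carry the same
    factor \<open>r t\<close>, so only the increment of the ramp survives.\<close>
  have defect_new: "defect d \<alpha> q' v = p v * (r (Suc t) - r t)"
    if v: "v \<in> layer d (Suc t)" and s: "supp_size v = Suc j" for v t
  proof -
    have "(\<Sum>u\<in>parents d v. q' u) = (\<Sum>u\<in>parents d v. harm_ext d \<alpha> j q t u) * r t"
      unfolding sum_distrib_right
      by (intro sum.cong refl) (metis p_layer parents_layer[OF v])
    moreover have "p v = \<alpha> (supp_size v) * (\<Sum>u\<in>parents d v. harm_ext d \<alpha> j q t u)"
      using p_layer(1)[OF v] s by simp
    ultimately show ?thesis
      using p_layer(2)[OF v] by (simp add: defect_def algebra_simps)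
  qed
  have new_energy: "(\<Sum>v\<in>{v \<in> layer d (Suc t). supp_size v = Suc j}. (defect d \<alpha> q' v)\<^sup>2)
      \<le> of_bool (t \<in> {T..<T + n}) * (?C / (real n)\<^sup>2)" for t
  proof (cases "t \<in> {T..<T + n}")
    case True
    have "(\<Sum>v\<in>{v \<in> layer d (Suc t). supp_size v = Suc j}. (defect d \<alpha> q' v)\<^sup>2)
        \<le> (\<Sum>v\<in>{v \<in> layer d (Suc t). supp_size v = Suc j}. p v * (1 / (real n)\<^sup>2))"
    proof (rule sum_mono)
      fix v assume v: "v \<in> {v \<in> layer d (Suc t). supp_size v = Suc j}"
      then have b: "0 \<le> p v" "p v \<le> 1" using p_bounds by blast+
      have "(defect d \<alpha> q' v)\<^sup>2 = (p v)\<^sup>2 * (1 / (real n)\<^sup>2)"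
        using v True by (simp add: defect_new[of v t] power_mult_distrib r_diff)
      \<comment> \<open>Values in \<open>[0, 1]\<close> let the square be replaced by the value
        itself, so energy is bounded by mass.\<close>
      also have "\<dots> \<le> p v * (1 / (real n)\<^sup>2)"
        using b mult_left_le[of "p v" "p v"]
        by (intro mult_right_mono) (auto simp: power2_eq_square)
      finally show "(defect d \<alpha> q' v)\<^sup>2 \<le> p v * (1 / (real n)\<^sup>2)" .
    qed
    also have "\<dots> = (\<Sum>v\<in>layer d (Suc t). of_bool (supp_size v = Suc j)
        * harm_ext d \<alpha> j q (Suc t) v) * (1 / (real n)\<^sup>2)"
      unfolding sum_distrib_right[symmetric]
      by (simp add: sum.inter_filter p_layer(1) of_bool_def if_distrib[of "\<lambda>x. x * _"]
          cong: if_cong sum.cong)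
    also have "\<dots> \<le> ?C * (1 / (real n)\<^sup>2)"
    proof (rule mult_right_mono)
      show "(\<Sum>v\<in>layer d (Suc t). of_bool (supp_size v = Suc j) * harm_ext d \<alpha> j q (Suc t) v) \<le> ?C"
        by (rule harm_ext_mass_le[OF \<alpha> q q0]) (use True in auto)
    qed simp
    finally show ?thesis using True by simp
  next
    case False
    then show ?thesis by (auto simp: defect_new power_mult_distrib r_diff intro!: sum_nonpos)
  qed
  have energy: "(\<Sum>t<N. \<Sum>v\<in>{v \<in> layer d (Suc t). supp_size v \<le> Suc j}. (defect d \<alpha> q' v)\<^sup>2)
      \<le> (\<Sum>t<N. \<Sum>v\<in>{v \<in> layer d (Suc t). supp_size v \<le> j}. (defect d \<alpha> q v)\<^sup>2) + ?C / real n"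
    for N
  proof -
    have split: "(\<Sum>v\<in>{v \<in> layer d (Suc t). supp_size v \<le> Suc j}. (defect d \<alpha> q' v)\<^sup>2)
      = (\<Sum>v\<in>{v \<in> layer d (Suc t). supp_size v \<le> j}. (defect d \<alpha> q v)\<^sup>2)
        + (\<Sum>v\<in>{v \<in> layer d (Suc t). supp_size v = Suc j}. (defect d \<alpha> q' v)\<^sup>2)" for t
    proof -
      have "{v \<in> layer d (Suc t). supp_size v \<le> Suc j} = {v \<in> layer d (Suc t). supp_size v \<le> j}
          \<union> {v \<in> layer d (Suc t). supp_size v = Suc j}" by auto
      then have "(\<Sum>v\<in>{v \<in> layer d (Suc t). supp_size v \<le> Suc j}. (defect d \<alpha> q' v)\<^sup>2)
          = (\<Sum>v\<in>{v \<in> layer d (Suc t). supp_size v \<le> j}. (defect d \<alpha> q' v)\<^sup>2)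
          + (\<Sum>v\<in>{v \<in> layer d (Suc t). supp_size v = Suc j}. (defect d \<alpha> q' v)\<^sup>2)"
        by (simp only:) (rule sum.union_disjoint, auto)
      moreover have "(\<Sum>v\<in>{v \<in> layer d (Suc t). supp_size v \<le> j}. (defect d \<alpha> q' v)\<^sup>2)
          = (\<Sum>v\<in>{v \<in> layer d (Suc t). supp_size v \<le> j}. (defect d \<alpha> q v)\<^sup>2)"
        by (intro sum.cong refl) (use defect_old in auto)
      ultimately show ?thesis by simp
    qed
    have "(\<Sum>t<N. of_bool (t \<in> {T..<T + n}) * (?C / (real n)\<^sup>2))
        = real (card ({..<N} \<inter> {T..<T + n})) * (?C / (real n)\<^sup>2)"
      by (simp only: sum_distrib_right[symmetric] sum_of_bool_eq finite_lessThan Collect_mem_eq)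
    also have "\<dots> \<le> real n * (?C / (real n)\<^sup>2)"
      using card_mono[of "{T..<T + n}" "{..<N} \<inter> {T..<T + n}"] by (intro mult_right_mono) auto
    also have "\<dots> = ?C / real n" using n by (simp add: power2_eq_square)
    finally have "(\<Sum>t<N. of_bool (t \<in> {T..<T + n}) * (?C / (real n)\<^sup>2)) \<le> ?C / real n" .
    moreover have "(\<Sum>t<N. \<Sum>v\<in>{v \<in> layer d (Suc t). supp_size v = Suc j}. (defect d \<alpha> q' v)\<^sup>2)
        \<le> (\<Sum>t<N. of_bool (t \<in> {T..<T + n}) * (?C / (real n)\<^sup>2))"
      by (intro sum_mono new_energy)
    ultimately show ?thesis unfolding split sum.distrib by linarith
  qed
  show ?thesis
  proof (rule that[of q'])
    show "0 \<le> q' v \<and> q' v \<le> 1" if "v \<in> layer d t" for t v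
      using p_bounds[OF that] r[of t] p_layer(2)[OF that] by (auto intro!: mult_le_one)
    show "q' v = 1" if "v \<in> layer d 0" for v
      using p_layer[OF that] q1[OF that] r1[of 0] by simp
    show "q' v = 0" if "T + n \<le> t" "v \<in> layer d t" for t v
      using p_layer(2)[OF that(2)] r0[OF that(1)] by simp
  qed (rule energy)
qed

text \<open>Induction on the face dimension, one half of the budget going to the smaller faces and
  one half to the new ramp. At \<open>j = Suc d\<close> every \<open>v\<close> is included.\<close>

lemma small_defect_exists:
  fixes \<alpha> :: "nat \<Rightarrow> real"
  assumes \<alpha>: "\<And>i. i \<in> {1..Suc d} \<Longrightarrow> 0 < \<alpha> i \<and> \<alpha> i * real i \<le> 1"
    and "0 < \<epsilon>"
  shows "\<exists>q T. (\<forall>t. \<forall>v\<in>layer d t. 0 \<le> q v \<and> q v \<le> (1::real)) \<and> (\<forall>v\<in>layer d 0. q v = 1) \<and>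
    (\<forall>t\<ge>T. \<forall>v\<in>layer d t. supp_size v \<le> j \<longrightarrow> q v = 0) \<and>
    (\<forall>N. (\<Sum>t<N. \<Sum>v\<in>{v \<in> layer d (Suc t). supp_size v \<le> j}. (defect d \<alpha> q v)\<^sup>2) \<le> \<epsilon>)"
  using \<open>0 < \<epsilon>\<close>
proof (induction j arbitrary: \<epsilon>)
  case 0
  have pos: "supp_size v \<noteq> 0" if "v \<in> layer d (Suc t)" for v t
    using supp_size_pos[OF that] by simp
  have "supp_size v \<noteq> 0" if "1 \<le> t" "v \<in> layer d t" for v t
    using that pos by (cases t) auto
  moreover have "{v \<in> layer d (Suc t). supp_size v \<le> 0} = {}" for t
    using pos by auto
  \<comment> \<open>Only the origin has empty support, so \<open>q = 1\<close> and
    \<open>T = 1\<close> leave nothing to check beyond rank 0.\<close>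
  ultimately show ?case
    using 0 by (intro exI[of _ "\<lambda>v. 1"] exI[of _ 1]) (simp only: sum.empty, auto)
next
  case (Suc j)
  have "0 < \<epsilon> / 2" using Suc.prems by simp
  from Suc.IH[OF this] obtain q T
    where q: "\<forall>t. \<forall>v\<in>layer d t. 0 \<le> q v \<and> q v \<le> (1::real)" and q1: "\<forall>v\<in>layer d 0. q v = 1"
    and q0: "\<forall>t\<ge>T. \<forall>v\<in>layer d t. supp_size v \<le> j \<longrightarrow> q v = 0"
    and E: "\<And>N. (\<Sum>t<N. \<Sum>v\<in>{v \<in> layer d (Suc t). supp_size v \<le> j}. (defect d \<alpha> q v)\<^sup>2) \<le> \<epsilon> / 2"
    by blast
  \<comment> \<open>\<open>n\<close> is chosen after \<open>T\<close>, which is possible because the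
    mass bound does not involve \<open>n\<close>.\<close>
  obtain n where n: "real (card (layer d T)) / (\<epsilon> / 2) < real n" using reals_Archimedean2 by blast
  moreover have "0 \<le> real (card (layer d T)) / (\<epsilon> / 2)" using Suc.prems by simp
  ultimately have "0 < n" by (metis gr0I of_nat_0 not_less)
  have n': "real (card (layer d T)) / real n \<le> \<epsilon> / 2"
    using n \<open>0 < n\<close> Suc.prems by (simp add: field_simps)
  obtain q' where q': "\<And>t v. v \<in> layer d t \<Longrightarrow> 0 \<le> q' v \<and> q' v \<le> (1::real)"
    "\<And>v. v \<in> layer d 0 \<Longrightarrow> q' v = 1"
    "\<And>t v. T + n \<le> t \<Longrightarrow> v \<in> layer d t \<Longrightarrow> supp_size v \<le> Suc j \<Longrightarrow> q' v = 0"
    "\<And>N. (\<Sum>t<N. \<Sum>v\<in>{v \<in> layer d (Suc t). supp_size v \<le> Suc j}. (defect d \<alpha> q' v)\<^sup>2)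
      \<le> (\<Sum>t<N. \<Sum>v\<in>{v \<in> layer d (Suc t). supp_size v \<le> j}. (defect d \<alpha> q v)\<^sup>2)
        + real (card (layer d T)) / real n"
    by (rule small_defect_step[OF \<alpha> _ _ _ \<open>0 < n\<close>, where q = q and T = T and j = j]) (use q q1 q0 in \<open>auto\<close>)
  have "(\<Sum>t<N. \<Sum>v\<in>{v \<in> layer d (Suc t). supp_size v \<le> Suc j}. (defect d \<alpha> q' v)\<^sup>2) \<le> \<epsilon>" for N
    using q'(4)[of N] E[of N] n' by linarith
  then show ?case
    using q'(1-3) by (intro exI[of _ q'] exI[of _ "T + n"]) blast
qed

subsection \<open>Second moments of the broadcast\<close>

lemma var_centered_L2: "centered_L2 M f \<Longrightarrow> var M f = ip M f f"
  by (simp add: var_def ip_def centered_L2_def power2_eq_square)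

lemma covar_centered_L2: "centered_L2 M f \<Longrightarrow> centered_L2 M g \<Longrightarrow> covar M f g = ip M f g"
  by (simp add: covar_def ip_def centered_L2_def)

text \<open>Grouping the covering pairs by rank assigns each source \<open>W e\<close> to exactly
  one step from layer \<open>t\<close> to layer \<open>Suc t\<close>.\<close>

definition edges :: "nat \<Rightarrow> nat \<Rightarrow> (nat list \<times> nat list) set" where
  "edges d t = {(u, v). v \<in> layer d (Suc t) \<and> u \<in> parents d v}"

lemma edges_eq_image: "edges d t = (\<lambda>(v, u). (u, v)) ` (SIGMA v:layer d (Suc t). parents d v)"
  by (auto simp: edges_def)

lemma finite_edges [simp]: "finite (edges d t)"
  by (simp add: edges_eq_image)

lemma sum_edges: "sum F (edges d t) = (\<Sum>v\<in>layer d (Suc t). \<Sum>u\<in>parents d v. F (u, v))"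
  by (simp add: edges_eq_image sum.reindex inj_on_def sum.Sigma case_prod_unfold)

lemma edges_disjoint: "t \<noteq> t' \<Longrightarrow> edges d t \<inter> edges d t' = {}"
  by (auto simp: edges_def layer_def)

lemma edges_subset_covers: "edges d t \<subseteq> covers d"
  by (auto simp: edges_def covers_def layer_def)

locale broadcast = prob_space M
  for M :: "'a measure" +
  fixes d :: nat and \<alpha> :: "nat \<Rightarrow> real" and X0 :: "'a \<Rightarrow> real"
    and W :: "nat list \<times> nat list \<Rightarrow> 'a \<Rightarrow> real"
  assumes model: "gaussian_broadcast M d X0 W"
    and alpha_pos: "\<And>i. i \<in> {1..Suc d} \<Longrightarrow> 0 < \<alpha> i"
begin

abbreviation X :: "nat \<Rightarrow> nat list \<Rightarrow> 'a \<Rightarrow> real" where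
  "X t v \<equiv> Xr d t \<alpha> X0 W v"

section \<open>Orthonormality of the sources and covariances of the broadcast values\<close>

lemma X0_L2: "centered_L2 M X0" and ip_X0_X0: "ip M X0 X0 = 1"
  using model by (auto simp: gaussian_broadcast_def intro: std_normal_centered_L2)

lemma W_L2: "e \<in> covers d \<Longrightarrow> centered_L2 M (W e)"
  and ip_W_self: "e \<in> covers d \<Longrightarrow> ip M (W e) (W e) = 1"
  using model by (auto simp: gaussian_broadcast_def intro: std_normal_centered_L2)

lemma indep_sources:
  "indep_vars (\<lambda>_. borel) (\<lambda>i. case i of None \<Rightarrow> X0 | Some e \<Rightarrow> W e) (insert None (Some ` covers d))"
  using model by (simp add: gaussian_broadcast_def)

lemma ip_X0_W: "e \<in> covers d \<Longrightarrow> ip M X0 (W e) = 0"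
  using indep_vars_ip_eq_0[OF indep_sources, of None "Some e"] X0_L2 W_L2 by simp

lemma ip_W_W: "e \<in> covers d \<Longrightarrow> e' \<in> covers d \<Longrightarrow> ip M (W e) (W e') = of_bool (e = e')"
  using indep_vars_ip_eq_0[OF indep_sources, of "Some e" "Some e'"] W_L2 ip_W_self
  by (cases "e = e'") auto

lemma parents_covers: "v \<in> layer d t \<Longrightarrow> u \<in> parents d v \<Longrightarrow> (u, v) \<in> covers d"
  by (simp add: covers_def layer_def)

lemma X_L2: "v \<in> layer d t \<Longrightarrow> centered_L2 M (X t v)"
proof (induction t arbitrary: v)
  case 0
  then show ?case by (simp add: X0_L2)
next
  case (Suc t)
  then show ?case
    by (auto intro!: centered_L2_cmult centered_L2_sum centered_L2_add Suc.IH W_L2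
        parents_layer[OF Suc.prems] parents_covers[OF Suc.prems])
qed

text \<open>The covariance with a fixed \<open>h\<close> inherits the recursion of \<open>X\<close>;
  this is applied to a single edge source and to the corrected root variable \<open>X0 + Y\<close>
  of part (b).\<close>

lemma ip_X_Suc:
  assumes v: "v \<in> layer d (Suc t)" and h: "centered_L2 M h"
  shows "ip M (X (Suc t) v) h =
    \<alpha> (supp_size v) * (\<Sum>u\<in>parents d v. ip M (X t u) h + ip M (W (u, v)) h)"
proof -
  have 1: "centered_L2 M (X t u)" "centered_L2 M (W (u, v))" if "u \<in> parents d v" for u
    using X_L2[OF parents_layer[OF v that]] W_L2[OF parents_covers[OF v that]] by auto
  have "ip M (X (Suc t) v) h =
      \<alpha> (supp_size v) * ip M (\<lambda>\<omega>. \<Sum>u\<in>parents d v. X t u \<omega> + W (u, v) \<omega>) h"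
    using card_parents[OF layer_length[OF v]] by (simp add: ip_cmult_left)
  also have "ip M (\<lambda>\<omega>. \<Sum>u\<in>parents d v. X t u \<omega> + W (u, v) \<omega>) h =
      (\<Sum>u\<in>parents d v. ip M (\<lambda>\<omega>. X t u \<omega> + W (u, v) \<omega>) h)"
    by (rule ip_sum_left) (auto intro: centered_L2_add 1 h)
  also have "\<dots> = (\<Sum>u\<in>parents d v. ip M (X t u) h + ip M (W (u, v)) h)"
    by (intro sum.cong refl ip_add_left 1 h)
  finally show ?thesis .
qed

text \<open>\<open>X t v\<close> is built from \<open>X0\<close> and from edges whose upper end has
  rank at most \<open>t\<close>; all of these sources are orthogonal to
  \<open>W (a, b)\<close>.\<close>

lemma ip_X_W_later:
  assumes "v \<in> layer d t" "(a, b) \<in> covers d" "t < sum_list b"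
  shows "ip M (X t v) (W (a, b)) = 0"
  using assms(1,3)
proof (induction t arbitrary: v)
  case 0
  then show ?case using ip_X0_W[OF assms(2)] by simp
next
  case (Suc t)
  have "v \<noteq> b" using Suc.prems by (auto simp: layer_def)
  then have "ip M (W (u, v)) (W (a, b)) = 0" if "u \<in> parents d v" for u
    using ip_W_W[OF parents_covers[OF Suc.prems(1) that] assms(2)] by simp
  moreover have "ip M (X t u) (W (a, b)) = 0" if "u \<in> parents d v" for u
    using Suc.IH[OF parents_layer[OF Suc.prems(1) that]] Suc.prems(2) by simp
  ultimately show ?case
    unfolding ip_X_Suc[OF Suc.prems(1) W_L2[OF assms(2)]] by simp
qed

text \<open>Serves twice: as the correction \<open>Y\<close> in part (b) and as the fresh noise of
  one layer in part (a).\<close>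

definition noise :: "(nat list \<times> nat list) set \<Rightarrow> (nat list \<times> nat list \<Rightarrow> real) \<Rightarrow> 'a \<Rightarrow> real" where
  "noise E \<theta> = (\<lambda>\<omega>. \<Sum>e\<in>E. \<theta> e * W e \<omega>)"

lemma noise_L2: "E \<subseteq> covers d \<Longrightarrow> centered_L2 M (noise E \<theta>)"
  unfolding noise_def by (intro centered_L2_sum centered_L2_cmult W_L2) auto

lemma ip_noise:
  "E \<subseteq> covers d \<Longrightarrow> centered_L2 M h \<Longrightarrow> ip M h (noise E \<theta>) = (\<Sum>e\<in>E. \<theta> e * ip M h (W e))"
  unfolding noise_def
  by (subst ip_sum_right) (auto intro: centered_L2_cmult W_L2 simp: ip_cmult_right)

lemma ip_W_noise:
  assumes "E \<subseteq> covers d" "finite E" "e \<in> E"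
  shows "ip M (W e) (noise E \<theta>) = \<theta> e"
proof -
  have "ip M (W e) (noise E \<theta>) = (\<Sum>e'\<in>E. \<theta> e' * ip M (W e) (W e'))"
    using assms by (intro ip_noise W_L2) auto
  also have "\<dots> = (\<Sum>e'\<in>E. if e' = e then \<theta> e else 0)"
    using assms by (intro sum.cong refl, subst ip_W_W) auto
  also have "\<dots> = \<theta> e" using assms by (subst sum.delta) auto
  finally show ?thesis .
qed

lemma ip_noise_self:
  assumes "E \<subseteq> covers d" "finite E"
  shows "ip M (noise E \<theta>) (noise E \<theta>) = (\<Sum>e\<in>E. (\<theta> e)\<^sup>2)"
proof -
  have "ip M (noise E \<theta>) (noise E \<theta>) = (\<Sum>e\<in>E. \<theta> e * ip M (noise E \<theta>) (W e))"
    using assms by (intro ip_noise noise_L2)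
  also have "\<dots> = (\<Sum>e\<in>E. (\<theta> e)\<^sup>2)"
    using ip_W_noise[OF assms]
    by (intro sum.cong refl) (simp add: ip_commute[of M "noise E \<theta>"] power2_eq_square)
  finally show ?thesis .
qed

lemma ip_X0_noise: "E \<subseteq> covers d \<Longrightarrow> ip M X0 (noise E \<theta>) = 0"
  by (subst ip_noise) (auto simp: X0_L2 ip_X0_W intro!: sum.neutral)

section \<open>The estimators in terms of inner products\<close>

definition Z :: "(nat list \<Rightarrow> real) \<Rightarrow> nat \<Rightarrow> 'a \<Rightarrow> real" where
  "Z c t = (\<lambda>\<omega>. \<Sum>v\<in>layer d t. c v * X t v \<omega>)"

lemma zeta_eq_Z: "zeta d \<alpha> X0 W c t = Z c t"
proof
  fix \<omega>
  have "zeta d \<alpha> X0 W c t \<omega> = (\<Sum>u\<in>{u \<in> layer d t. c u \<noteq> 0}. c u * X t u \<omega>)"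
    unfolding zeta_def by (intro sum.cong refl) (auto simp: Xv_def layer_def)
  also have "\<dots> = Z c t \<omega>"
    unfolding Z_def by (intro sum.mono_neutral_left) auto
  finally show "zeta d \<alpha> X0 W c t \<omega> = Z c t \<omega>" .
qed

lemma Z_L2: "centered_L2 M (Z c t)"
  unfolding Z_def by (intro centered_L2_sum centered_L2_cmult X_L2)

lemma ip_Z: "centered_L2 M h \<Longrightarrow> ip M (Z c t) h = (\<Sum>v\<in>layer d t. c v * ip M (X t v) h)"
  unfolding Z_def
  by (subst ip_sum_left) (auto intro: centered_L2_cmult X_L2 simp: ip_cmult_left)

lemma corr_zeta:
  "corr M (zeta d \<alpha> X0 W c t) X0 = ip M (Z c t) X0 / sqrt (ip M (Z c t) (Z c t))"
  by (simp add: corr_def zeta_eq_Z var_centered_L2 covar_centered_L2 Z_L2 X0_L2 ip_X0_X0)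

lemma good_coeffs_iff: "good_coeffs M d \<alpha> X0 W c \<longleftrightarrow>
    (\<forall>t. 0 < ip M (Z c t) (Z c t)) \<and>
    \<not> (\<lambda>t. ip M (Z c t) X0 / sqrt (ip M (Z c t) (Z c t))) \<longlonglongrightarrow> 0"
  unfolding good_coeffs_def corr_zeta by (simp add: zeta_eq_Z var_centered_L2 Z_L2)

subsection \<open>Impossibility of reconstruction\<close>

text \<open>Cauchy-Schwarz against the correction \<open>Y\<close>. Creating the defect at
  \<open>v\<close> costs \<open>(defect d \<alpha> q v)\<^sup>2 / ((\<alpha> k)\<^sup>2 * real
  k)\<close> with \<open>k = supp_size v\<close>, and \<open>a\<close> bounds this denominator from
  below for all \<open>k\<close>.\<close>

lemma ip_Z_X0_bound:
  assumes q1: "\<And>v. v \<in> layer d 0 \<Longrightarrow> q v = 1" and qN: "\<And>v. v \<in> layer d N \<Longrightarrow> q v = 0"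
    and a: "0 < a" "\<And>i. i \<in> {1..Suc d} \<Longrightarrow> a \<le> (\<alpha> i)\<^sup>2 * real i"
    and E: "(\<Sum>t<N. \<Sum>v\<in>layer d (Suc t). (defect d \<alpha> q v)\<^sup>2) \<le> \<epsilon>"
  shows "(ip M (Z c N) X0)\<^sup>2 \<le> ip M (Z c N) (Z c N) * (\<epsilon> / a)"
proof -
  \<comment> \<open>The defect is split evenly over the \<open>k\<close> edges into
    \<open>v\<close>; each edge enters \<open>X_v\<close> with factor \<open>\<alpha> k\<close>, so
    the share of an edge is the defect divided by \<open>\<alpha> k * real k\<close>.\<close>
  define \<theta> :: "nat list \<times> nat list \<Rightarrow> real" where "\<theta> e = (case e of (u, v) \<Rightarrow>
    defect d \<alpha> q v / (\<alpha> (supp_size v) * real (supp_size v)))" for e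
  have \<theta>: "\<theta> (u, v) = defect d \<alpha> q v / (\<alpha> (supp_size v) * real (supp_size v))" for u v
    by (simp add: \<theta>_def)
  define E where "E = (\<Union>t<N. edges d t)"
  have E_sub: "E \<subseteq> covers d" using edges_subset_covers by (auto simp: E_def)
  have E_fin: "finite E" by (simp add: E_def)
  let ?Y = "noise E \<theta>"
  have Y: "centered_L2 M ?Y" by (rule noise_L2[OF E_sub])
  have XY: "centered_L2 M (\<lambda>\<omega>. X0 \<omega> + ?Y \<omega>)" by (rule centered_L2_add[OF X0_L2 Y])
  have supp: "supp_size v \<in> {1..Suc d}" if "v \<in> layer d (Suc t)" for v t
    using supp_size_pos[OF that] supp_size_le[OF layer_length[OF that]] by simp
  have X_q: "ip M (X t v) (\<lambda>\<omega>. X0 \<omega> + ?Y \<omega>) = q v" if "v \<in> layer d t" "t \<le> N" for t v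
    using that
  proof (induction t arbitrary: v)
    case 0
    then show ?case
      using q1 by (simp add: ip_add_right X0_L2 Y ip_X0_X0 ip_X0_noise E_sub)
  next
    case (Suc t)
    let ?k = "supp_size v"
    have k: "0 < ?k" "0 < \<alpha> ?k" using supp[OF Suc.prems(1)] alpha_pos by auto
    have "ip M (X t u) (\<lambda>\<omega>. X0 \<omega> + ?Y \<omega>) + ip M (W (u, v)) (\<lambda>\<omega>. X0 \<omega> + ?Y \<omega>) =
        q u + defect d \<alpha> q v / (\<alpha> ?k * real ?k)" if u: "u \<in> parents d v" for u
    proof -
      have e: "(u, v) \<in> covers d" "(u, v) \<in> E"
        using Suc.prems u by (auto simp: parents_covers E_def edges_def)
      have "ip M (W (u, v)) (\<lambda>\<omega>. X0 \<omega> + ?Y \<omega>) = ip M (W (u, v)) X0 + ip M (W (u, v)) ?Y"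
        by (intro ip_add_right X0_L2 Y W_L2 e)
      also have "\<dots> = \<theta> (u, v)"
        using ip_X0_W[OF e(1)] ip_W_noise[OF E_sub E_fin e(2)] by (simp add: ip_commute[of M _ X0])
      finally show ?thesis
        using Suc.IH[OF parents_layer[OF Suc.prems(1) u]] Suc.prems(2) by (simp add: \<theta>)
    qed
    then have "ip M (X (Suc t) v) (\<lambda>\<omega>. X0 \<omega> + ?Y \<omega>) =
        \<alpha> ?k * (\<Sum>u\<in>parents d v. q u + defect d \<alpha> q v / (\<alpha> ?k * real ?k))"
      unfolding ip_X_Suc[OF Suc.prems(1) XY] by (intro arg_cong2[where f = "(*)"] refl sum.cong)
    also have "\<dots> = \<alpha> ?k * (\<Sum>u\<in>parents d v. q u) + defect d \<alpha> q v"
      using k card_parents[OF layer_length[OF Suc.prems(1)]]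
      by (simp add: sum.distrib distrib_left)
    finally show ?case by (simp add: defect_def)
  qed
  \<comment> \<open>Since \<open>q\<close> vanishes on layer \<open>N\<close>, the estimator there
    is orthogonal to \<open>X0 + Y\<close>, and \<open>X0\<close> may be traded for
    \<open>- Y\<close>.\<close>
  have "ip M (Z c N) (\<lambda>\<omega>. X0 \<omega> + ?Y \<omega>) = 0"
    unfolding ip_Z[OF XY] by (intro sum.neutral) (simp add: X_q qN)
  then have "ip M (Z c N) X0 = - ip M (Z c N) ?Y"
    by (simp add: ip_add_right X0_L2 Y Z_L2)
  then have "(ip M (Z c N) X0)\<^sup>2 \<le> ip M (Z c N) (Z c N) * ip M ?Y ?Y"
    using ip_Cauchy_Schwarz[OF Z_L2[of c N] Y] by simp
  also have "\<dots> \<le> ip M (Z c N) (Z c N) * (\<epsilon> / a)"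
  proof (rule mult_left_mono[OF _ ip_nonneg])
    have "ip M ?Y ?Y = (\<Sum>t<N. sum (\<lambda>e. (\<theta> e)\<^sup>2) (edges d t))"
      unfolding ip_noise_self[OF E_sub E_fin] unfolding E_def
      by (rule sum.UNION_disjoint) (auto dest: edges_disjoint)
    also have "\<dots> \<le> (\<Sum>t<N. \<Sum>v\<in>layer d (Suc t). (defect d \<alpha> q v)\<^sup>2 / a)"
      unfolding sum_edges
    proof (intro sum_mono)
      fix t v assume v: "v \<in> layer d (Suc t)"
      let ?k = "supp_size v"
      have k: "0 < ?k" "0 < \<alpha> ?k" "a \<le> (\<alpha> ?k)\<^sup>2 * real ?k" using supp[OF v] alpha_pos a by auto
      have "(\<Sum>u\<in>parents d v. (\<theta> (u, v))\<^sup>2) = (defect d \<alpha> q v)\<^sup>2 / ((\<alpha> ?k)\<^sup>2 * real ?k)"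
        using k card_parents[OF layer_length[OF v]]
        by (simp add: \<theta> power_divide power_mult_distrib power2_eq_square)
      also have "\<dots> \<le> (defect d \<alpha> q v)\<^sup>2 / a"
        using k a(1) by (intro divide_left_mono) auto
      finally show "(\<Sum>u\<in>parents d v. (\<theta> (u, v))\<^sup>2) \<le> (defect d \<alpha> q v)\<^sup>2 / a" .
    qed
    also have "\<dots> = (\<Sum>t<N. \<Sum>v\<in>layer d (Suc t). (defect d \<alpha> q v)\<^sup>2) / a"
      by (simp add: sum_divide_distrib)
    also have "\<dots> \<le> \<epsilon> / a" using E a(1) by (intro divide_right_mono) auto
    finally show "ip M ?Y ?Y \<le> \<epsilon> / a" .
  qed
  finally show ?thesis .
qed

lemma not_reconstruction_possible:
  assumes \<alpha>: "\<And>i. i \<in> {1..Suc d} \<Longrightarrow> \<alpha> i \<le> 1 / real i"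
  shows "\<not> reconstruction_possible M d \<alpha> X0 W"
proof
  assume "reconstruction_possible M d \<alpha> X0 W"
  then obtain c where pos: "\<And>t. 0 < ip M (Z c t) (Z c t)"
    and nlim: "\<not> (\<lambda>t. ip M (Z c t) X0 / sqrt (ip M (Z c t) (Z c t))) \<longlonglongrightarrow> 0"
    by (auto simp: reconstruction_possible_def good_coeffs_iff)
  define a where "a = Min ((\<lambda>i. (\<alpha> i)\<^sup>2 * real i) ` {1..Suc d})"
  have "a \<in> (\<lambda>i. (\<alpha> i)\<^sup>2 * real i) ` {1..Suc d}" unfolding a_def by (rule Min_in) auto
  then have a0: "0 < a" using alpha_pos by force
  have a: "a \<le> (\<alpha> i)\<^sup>2 * real i" if "i \<in> {1..Suc d}" for i
    unfolding a_def using that by (intro Min_le) auto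
  have \<alpha>': "0 < \<alpha> i \<and> \<alpha> i * real i \<le> 1" if "i \<in> {1..Suc d}" for i
    using alpha_pos[OF that] \<alpha>[OF that] that by (simp add: field_simps)
  have "(\<lambda>t. ip M (Z c t) X0 / sqrt (ip M (Z c t) (Z c t))) \<longlonglongrightarrow> 0"
  proof (rule LIMSEQ_I)
    fix r :: real assume "0 < r"
    \<comment> \<open>This makes \<open>\<epsilon> / a = r\<^sup>2 / 2\<close>, strictly below
      \<open>r\<^sup>2\<close>. The \<open>q\<close> and \<open>T\<close> obtained from it do not
      depend on \<open>t\<close>, so they serve all layers from \<open>T\<close> on.\<close>
    define \<epsilon> where "\<epsilon> = r\<^sup>2 * a / 2"
    have "0 < \<epsilon>" using \<open>0 < r\<close> a0 by (simp add: \<epsilon>_def)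
    from small_defect_exists[where d = d and j = "Suc d", OF \<alpha>' this] obtain q T where
      q1: "\<forall>v\<in>layer d 0. q v = 1"
      and q0: "\<forall>t\<ge>T. \<forall>v\<in>layer d t. supp_size v \<le> Suc d \<longrightarrow> q v = (0::real)"
      and E: "\<And>N. (\<Sum>t<N. \<Sum>v\<in>{v \<in> layer d (Suc t). supp_size v \<le> Suc d}. (defect d \<alpha> q v)\<^sup>2) \<le> \<epsilon>"
      by blast
    have all: "{v \<in> layer d (Suc t). supp_size v \<le> Suc d} = layer d (Suc t)" for t
      using supp_size_le[OF layer_length] by blast
    show "\<exists>T. \<forall>t\<ge>T. norm (ip M (Z c t) X0 / sqrt (ip M (Z c t) (Z c t)) - 0) < r"
    proof (intro exI allI impI)
      fix t assume t: "T \<le> t"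
      let ?V = "ip M (Z c t) (Z c t)"
      have "(ip M (Z c t) X0)\<^sup>2 \<le> ?V * (\<epsilon> / a)"
      proof (rule ip_Z_X0_bound[OF _ _ a0 a])
        show "q v = 0" if "v \<in> layer d t" for v
          using q0 t that supp_size_le[OF layer_length[OF that]] by blast
      qed (use q1 E[of t] in \<open>auto simp: all\<close>)
      also have "\<dots> < ?V * r\<^sup>2"
        using pos[of t] \<open>0 < r\<close> a0 by (simp add: \<epsilon>_def)
      finally have "(ip M (Z c t) X0 / sqrt ?V)\<^sup>2 < r\<^sup>2"
        using pos[of t] by (simp add: power_divide field_simps)
      then show "norm (ip M (Z c t) X0 / sqrt ?V - 0) < r"
        using \<open>0 < r\<close> power2_less_imp_less[of "\<bar>ip M (Z c t) X0 / sqrt ?V\<bar>" r]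
        unfolding real_norm_def diff_0_right power2_abs by linarith
    qed
  qed
  with nlim show False by blast
qed

end

subsection \<open>Convex reconstruction\<close>

text \<open>Ratio test: consecutive terms have ratio tending to \<open>x\<close>. This will sum the
  polynomially growing noise variances after rescaling by powers of
  \<open>\<rho>\<^sup>2\<close>.\<close>

lemma summable_poly_geometric:
  fixes x :: real
  assumes "0 < x" "x < 1"
  shows "summable (\<lambda>s. (real s + 2) ^ D * x ^ s)"
proof -
  define c where "c = (1 + x) / 2"
  have c: "x < c" "c < 1" using assms by (auto simp: c_def)
  have "(\<lambda>s. (real s + 3) / (real s + 2)) \<longlonglongrightarrow> 1" by real_asymp
  from tendsto_mult[OF tendsto_power[OF this, of D] tendsto_const[of x]]
  have "(\<lambda>s. ((real s + 3) / (real s + 2)) ^ D * x) \<longlonglongrightarrow> x" by simp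
  from order_tendstoD(2)[OF this c(1)]
  obtain N where N: "\<And>s. N \<le> s \<Longrightarrow> ((real s + 3) / (real s + 2)) ^ D * x < c"
    by (auto simp: eventually_sequentially)
  show ?thesis
  proof (rule summable_ratio_test[OF c(2), of N])
    fix s assume s: "N \<le> s"
    have "(real (Suc s) + 2) ^ D * x ^ Suc s =
        (((real s + 3) / (real s + 2)) ^ D * x) * ((real s + 2) ^ D * x ^ s)"
      by (simp add: power_divide add.commute)
    also have "\<dots> \<le> c * ((real s + 2) ^ D * x ^ s)"
      using N[OF s] assms by (intro mult_right_mono) auto
    finally show "norm ((real (Suc s) + 2) ^ D * x ^ Suc s) \<le> c * norm ((real s + 2) ^ D * x ^ s)"
      using assms by simp
  qed
qed

text \<open>On a face with \<open>k\<close> free coordinates, an element with \<open>j\<close>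
  positive ones has \<open>j\<close> upper covers of support size \<open>j\<close> and
  \<open>k - j\<close> of size \<open>Suc j\<close>, so this is an eigenvector equation for a
  triangular matrix. It is solved downwards from \<open>j = k\<close>, where it reduces to
  \<open>real k * \<alpha> k = \<rho>\<close>; \<open>small\<close> keeps the other pivots
  \<open>\<rho> - real j * \<alpha> j\<close> positive.\<close>

lemma weights_exist:
  fixes \<alpha> :: "nat \<Rightarrow> real"
  assumes \<alpha>: "\<And>i. i \<in> {1..k} \<Longrightarrow> 0 < \<alpha> i"
    and small: "\<And>i. i < k \<Longrightarrow> real i * \<alpha> i < \<rho>" and k: "real k * \<alpha> k = \<rho>"
  shows "\<exists>h. (\<forall>j. 0 \<le> h j) \<and> 0 < h 0 \<and>
    (\<forall>j\<le>k. real j * (h j * \<alpha> j) + real (k - j) * (h (Suc j) * \<alpha> (Suc j)) = \<rho> * h j)"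
proof -
  define f where "f l = real (k - l) * \<alpha> (Suc l) / (\<rho> - real l * \<alpha> l)" for l
  \<comment> \<open>The downward recursion \<open>h j = f j * h (Suc j)\<close>, normalised to 1 at
    \<open>j = k\<close> by the empty product.\<close>
  define h where "h j = prod f {j..<k}" for j
  have f_pos: "0 < f l" if "l < k" for l
    using that \<alpha>[of "Suc l"] small[of l] by (auto simp: f_def)
  have h_pos: "0 < h j" for j
    unfolding h_def by (rule prod_pos) (use f_pos in auto)
  have "real j * (h j * \<alpha> j) + real (k - j) * (h (Suc j) * \<alpha> (Suc j)) = \<rho> * h j" if "j \<le> k" for j
  proof (cases "j = k")
    case False
    then have "j < k" using that by simp
    then have "h j = f j * h (Suc j)" by (simp add: h_def prod.atLeast_Suc_lessThan)
    then have "(\<rho> - real j * \<alpha> j) * h j = real (k - j) * (h (Suc j) * \<alpha> (Suc j))"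
      using small[OF \<open>j < k\<close>] by (simp add: f_def)
    then show ?thesis by (simp add: algebra_simps)
  qed (use k in \<open>simp add: mult_ac\<close>)
  then show ?thesis using h_pos less_imp_le by blast
qed

text \<open>Upper covers that leave the face have weight zero, and the remaining ones are counted by
  support size; this gives the equation for \<open>h\<close> at
  \<open>j = supp_size u\<close>.\<close>

lemma sum_incr_weights:
  fixes h \<alpha> :: "nat \<Rightarrow> real"
  assumes u: "length u = Suc d" and k: "k \<le> Suc d"
    and h: "\<And>j. j \<le> k \<Longrightarrow>
      real j * (h j * \<alpha> j) + real (k - j) * (h (Suc j) * \<alpha> (Suc j)) = \<rho> * h j"
    and c: "\<And>v. c v = (if \<forall>i\<in>{k..<Suc d}. v ! i = 0 then h (supp_size v) else 0)"
  shows "(\<Sum>i<Suc d. c (incr u i) * \<alpha> (supp_size (incr u i))) = \<rho> * c u"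
proof (cases "\<forall>i\<in>{k..<Suc d}. u ! i = 0")
  case False
  then obtain l where l: "l \<in> {k..<Suc d}" "u ! l \<noteq> 0" by blast
  have "c (incr u i) = 0" for i
  proof -
    \<comment> \<open>Raising a coordinate cannot bring \<open>u\<close> back to the face.\<close>
    have "incr u i ! l \<noteq> 0" using l u by (cases "i = l") auto
    then show ?thesis using l(1) unfolding c by auto
  qed
  moreover have "c u = 0" using False unfolding c by auto
  ultimately show ?thesis by simp
next
  case True
  let ?s = "supp_size u"
  \<comment> \<open>Raising a coordinate in \<open>?P\<close> keeps the support size, raising one in
    \<open>?Q\<close> increases it by 1 inside the face, and raising any other leaves the
    face.\<close>
  let ?P = "{i. 0 < u ! i}" and ?Q = "{i. i < k \<and> u ! i = 0}"
  have P: "{..<Suc d} \<inter> ?P = {i. i < length u \<and> 0 < u ! i}" using u by auto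
  have "{i. i < length u \<and> 0 < u ! i} \<union> ?Q = {..<k}"
  proof -
    have "l < k" if "l < Suc d" "0 < u ! l" for l
      using True that by (cases "l < k") auto
    then show ?thesis using u k by auto
  qed
  moreover have "card ({i. i < length u \<and> 0 < u ! i} \<union> ?Q) = ?s + card ?Q"
    unfolding supp_size_def by (rule card_Un_disjoint) auto
  ultimately have sk: "?s + card ?Q = k" by simp
  have Q: "{..<Suc d} \<inter> ?Q = ?Q" using k by auto
  have face: "(\<forall>l\<in>{k..<Suc d}. incr u i ! l = 0) \<longleftrightarrow> i < k" if "i < Suc d" for i
    using True that u by (auto simp: nth_list_update)
  then have c_incr: "c (incr u i) = (if i < k then h (supp_size (incr u i)) else 0)"
    if "i < Suc d" for i
    using that by (simp only: c)
  have "c (incr u i) * \<alpha> (supp_size (incr u i)) =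
      of_bool (i \<in> ?P) * (h ?s * \<alpha> ?s) + of_bool (i \<in> ?Q) * (h (Suc ?s) * \<alpha> (Suc ?s))"
    if "i < Suc d" for i
  proof (cases "i < k")
    case True
    then show ?thesis using c_incr[OF that] supp_size_incr[OF u that] by simp
  next
    case False
    then have "u ! i = 0" using True that by auto
    then show ?thesis using c_incr[OF that] False by simp
  qed
  then have "(\<Sum>i<Suc d. c (incr u i) * \<alpha> (supp_size (incr u i))) =
      (\<Sum>i<Suc d. of_bool (i \<in> ?P) * (h ?s * \<alpha> ?s) + of_bool (i \<in> ?Q) * (h (Suc ?s) * \<alpha> (Suc ?s)))"
    by (intro sum.cong refl) auto
  also have "\<dots> = real (card ({..<Suc d} \<inter> ?P)) * (h ?s * \<alpha> ?s)
      + real (card ({..<Suc d} \<inter> ?Q)) * (h (Suc ?s) * \<alpha> (Suc ?s))"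
    by (simp only: sum.distrib sum_distrib_right[symmetric] sum_of_bool_eq finite_lessThan
        Collect_mem_eq)
  also have "\<dots> = real ?s * (h ?s * \<alpha> ?s) + real (k - ?s) * (h (Suc ?s) * \<alpha> (Suc ?s))"
    using sk by (simp only: P Q supp_size_def[symmetric]) simp
  also have "\<dots> = \<rho> * c u" using h[of ?s] sk True by (simp add: c)
  finally show ?thesis .
qed

section \<open>Growth of signal and variance for eigenvector weights\<close>

context broadcast
begin

text \<open>Regrouping by the lower element collects, as coefficient of \<open>X t u\<close>, the
  sum over its upper covers that the hypothesis on \<open>c\<close> evaluates; the edge sources
  remain as fresh noise.\<close>

lemma Z_Suc:
  assumes c: "\<And>u. u \<in> layer d t \<Longrightarrow>
    (\<Sum>i<Suc d. c (incr u i) * \<alpha> (supp_size (incr u i))) = \<rho> * c u"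
  shows "Z c (Suc t) =
    (\<lambda>\<omega>. \<rho> * Z c t \<omega> + noise (edges d t) (\<lambda>(u, v). c v * \<alpha> (supp_size v)) \<omega>)"
proof
  fix \<omega>
  have "Z c (Suc t) \<omega> = (\<Sum>v\<in>layer d (Suc t). \<Sum>u\<in>parents d v.
      c v * \<alpha> (supp_size v) * X t u \<omega> + c v * \<alpha> (supp_size v) * W (u, v) \<omega>)"
    unfolding Z_def
  proof (intro sum.cong refl)
    fix v assume "v \<in> layer d (Suc t)"
    then show "c v * X (Suc t) v \<omega> = (\<Sum>u\<in>parents d v.
        c v * \<alpha> (supp_size v) * X t u \<omega> + c v * \<alpha> (supp_size v) * W (u, v) \<omega>)"
      using card_parents[OF layer_length] by (simp add: sum_distrib_left distrib_left mult.assoc)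
  qed
  also have "\<dots> = (\<Sum>v\<in>layer d (Suc t). \<Sum>u\<in>parents d v. c v * \<alpha> (supp_size v) * X t u \<omega>)
      + noise (edges d t) (\<lambda>(u, v). c v * \<alpha> (supp_size v)) \<omega>"
    by (simp add: sum.distrib noise_def sum_edges)
  also have "(\<Sum>v\<in>layer d (Suc t). \<Sum>u\<in>parents d v. c v * \<alpha> (supp_size v) * X t u \<omega>) =
      (\<Sum>u\<in>layer d t. \<Sum>i<Suc d. c (incr u i) * \<alpha> (supp_size (incr u i)) * X t u \<omega>)"
    by (rule sum_layer_Suc_parents)
  also have "\<dots> = (\<Sum>u\<in>layer d t. \<rho> * c u * X t u \<omega>)"
    by (intro sum.cong refl) (simp only: sum_distrib_right[symmetric] c)
  also have "\<dots> = \<rho> * Z c t \<omega>" by (simp add: Z_def sum_distrib_left mult.assoc)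
  finally show "Z c (Suc t) \<omega> =
    \<rho> * Z c t \<omega> + noise (edges d t) (\<lambda>(u, v). c v * \<alpha> (supp_size v)) \<omega>" .
qed

text \<open>The edges in \<open>edges d t\<close> end at rank \<open>Suc t\<close>, so their sources
  have not yet entered \<open>Z c t\<close>; this makes the variance recursion additive.\<close>

lemma ip_Z_later_noise: "ip M (Z c t) (noise (edges d t) \<theta>) = 0"
proof -
  have "ip M (X t v) (noise (edges d t) \<theta>) = 0" if v: "v \<in> layer d t" for v
  proof -
    have "ip M (X t v) (W e) = 0" if "e \<in> edges d t" for e
    proof -
      obtain a b where "e = (a, b)" by (cases e)
      moreover have "e \<in> covers d" using that edges_subset_covers by blast
      moreover have "t < sum_list b" using that \<open>e = (a, b)\<close> by (simp add: edges_def layer_def)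
      ultimately show ?thesis using ip_X_W_later[OF v] by blast
    qed
    then show ?thesis
      by (simp add: ip_noise[OF edges_subset_covers X_L2[OF v]])
  qed
  then show ?thesis by (simp add: ip_Z noise_L2 edges_subset_covers)
qed

lemma convex_reconstruction:
  assumes ex: "\<exists>i\<in>{1..Suc d}. \<alpha> i > 1 / real i"
  shows "convex_reconstruction_possible M d \<alpha> X0 W"
proof -
  \<comment> \<open>Minimality gives \<open>real i * \<alpha> i \<le> 1 < \<rho>\<close> for
    \<open>1 \<le> i < k\<close>, as \<open>weights_exist\<close> requires.\<close>
  define k where "k = (LEAST i. i \<in> {1..Suc d} \<and> \<alpha> i > 1 / real i)"
  have k: "k \<in> {1..Suc d}" "\<alpha> k > 1 / real k"
    using LeastI_ex[of "\<lambda>i. i \<in> {1..Suc d} \<and> \<alpha> i > 1 / real i"] ex unfolding k_def by blast+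
  define \<rho> where "\<rho> = real k * \<alpha> k"
  have \<rho>: "1 < \<rho>" using k by (simp add: \<rho>_def field_simps)
  have "real i * \<alpha> i < \<rho>" if "i < k" for i
  \<comment> \<open>\<open>\<alpha> 0\<close> is unconstrained, but its factor is 0.\<close>
  proof (cases "i = 0")
    case False
    then have "\<alpha> i \<le> 1 / real i"
      using not_less_Least[of i "\<lambda>i. i \<in> {1..Suc d} \<and> \<alpha> i > 1 / real i"] that k(1)
      unfolding k_def[symmetric] by auto
    then have "real i * \<alpha> i \<le> 1" using False by (simp add: field_simps)
    then show ?thesis using \<rho> by linarith
  qed (use \<rho> in auto)
  then have "\<exists>h. (\<forall>j. 0 \<le> h j) \<and> 0 < h 0 \<and>
      (\<forall>j\<le>k. real j * (h j * \<alpha> j) + real (k - j) * (h (Suc j) * \<alpha> (Suc j)) = \<rho> * h j)"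
    using k(1) by (intro weights_exist) (auto intro!: alpha_pos simp: \<rho>_def)
  then obtain h where h0: "\<And>j. 0 \<le> h j" "0 < h 0" and h: "\<And>j. j \<le> k \<Longrightarrow>
      real j * (h j * \<alpha> j) + real (k - j) * (h (Suc j) * \<alpha> (Suc j)) = \<rho> * h j"
    by blast
  define c where "c v = (if \<forall>i\<in>{k..<Suc d}. v ! i = 0 then h (supp_size v) else 0)" for v :: "nat list"
  define \<theta> :: "nat list \<times> nat list \<Rightarrow> real" where "\<theta> = (\<lambda>(u, v). c v * \<alpha> (supp_size v))"
  define V where "V t = ip M (Z c t) (Z c t)" for t
  have c_incr: "(\<Sum>i<Suc d. c (incr u i) * \<alpha> (supp_size (incr u i))) = \<rho> * c u"
    if "u \<in> layer d t" for u t
    by (rule sum_incr_weights[OF layer_length[OF that] _ h c_def]) (use k in auto)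
  have Z_rec: "Z c (Suc t) = (\<lambda>\<omega>. \<rho> * Z c t \<omega> + noise (edges d t) \<theta> \<omega>)" for t
    unfolding \<theta>_def by (rule Z_Suc) (rule c_incr)
  have noise: "centered_L2 M (noise (edges d t) \<theta>)" for t
    by (rule noise_L2[OF edges_subset_covers])
  have \<rho>Z: "centered_L2 M (\<lambda>\<omega>. \<rho> * Z c t \<omega>)" for t by (rule centered_L2_cmult[OF Z_L2])
  have Z0: "Z c 0 = (\<lambda>\<omega>. h 0 * X0 \<omega>)"
  proof -
    have "{i. i < length (replicate (Suc d) (0::nat)) \<and> 0 < replicate (Suc d) (0::nat) ! i} = {}"
      by (auto simp del: replicate_Suc)
    then have "supp_size (replicate (Suc d) 0) = 0" by (simp only: supp_size_def card.empty)
    then show ?thesis by (simp add: Z_def layer_0 c_def del: replicate_Suc)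
  qed
  have cov: "ip M (Z c t) X0 = \<rho> ^ t * h 0" for t
  proof (induction t)
    case 0
    then show ?case by (simp add: Z0 ip_cmult_left ip_X0_X0)
  next
    case (Suc t)
    then show ?case
      unfolding Z_rec
      by (simp add: ip_add_left[OF \<rho>Z noise X0_L2] ip_cmult_left
          ip_commute[of M "noise _ _"] ip_X0_noise[OF edges_subset_covers])
  qed
  have V_pos: "0 < V t" for t
  proof -
    \<comment> \<open>Positive variance follows from the nonzero covariance with
      \<open>X0\<close>.\<close>
    have "0 < (ip M (Z c t) X0)\<^sup>2" using h0(2) \<rho> by (simp add: cov)
    also have "\<dots> \<le> V t" using ip_Cauchy_Schwarz[OF Z_L2 X0_L2] by (simp add: V_def ip_X0_X0)
    finally show ?thesis .
  qed
  \<comment> \<open>Summing over all support sizes bounds every squared edge coefficient at once;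
    \<open>K\<close> allows for up to \<open>Suc d\<close> edges into each element.\<close>
  define B where "B = (\<Sum>s\<le>Suc d. (h s * \<alpha> s)\<^sup>2)"
  define K where "K = real (Suc d) * B"
  have B0: "0 \<le> B" by (simp add: B_def sum_nonneg)
  have noise_var: "ip M (noise (edges d t) \<theta>) (noise (edges d t) \<theta>) \<le> K * (real t + 2) ^ Suc d" for t
  proof -
    have "ip M (noise (edges d t) \<theta>) (noise (edges d t) \<theta>) =
        (\<Sum>v\<in>layer d (Suc t). \<Sum>u\<in>parents d v. (c v * \<alpha> (supp_size v))\<^sup>2)"
      by (simp add: ip_noise_self[OF edges_subset_covers] sum_edges \<theta>_def)
    also have "\<dots> \<le> (\<Sum>v\<in>layer d (Suc t). K)"
    proof (rule sum_mono)
      fix v assume v: "v \<in> layer d (Suc t)"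
      note s = supp_size_le[OF layer_length[OF v]]
      have "(c v * \<alpha> (supp_size v))\<^sup>2 \<le> (h (supp_size v) * \<alpha> (supp_size v))\<^sup>2"
        by (simp add: c_def)
      also have "\<dots> \<le> B" unfolding B_def
        by (rule member_le_sum[where f = "\<lambda>s. (h s * \<alpha> s)\<^sup>2"]) (use s in auto)
      finally have "(\<Sum>u\<in>parents d v. (c v * \<alpha> (supp_size v))\<^sup>2) \<le> real (supp_size v) * B"
        using card_parents[OF layer_length[OF v]] by (simp add: mult_left_mono)
      also have "\<dots> \<le> K" unfolding K_def using s B0 by (intro mult_right_mono) auto
      finally show "(\<Sum>u\<in>parents d v. (c v * \<alpha> (supp_size v))\<^sup>2) \<le> K" .
    qed
    also have "\<dots> = K * real (card (layer d (Suc t)))" by simp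
    also have "\<dots> \<le> K * real (Suc (Suc t) ^ Suc d)"
      using card_layer_le[of d "Suc t"] B0 unfolding K_def
      by (intro mult_left_mono of_nat_mono) auto
    also have "real (Suc (Suc t) ^ Suc d) = (real t + 2) ^ Suc d"
      by (simp only: of_nat_power of_nat_Suc) (simp add: add.commute)
    finally show ?thesis .
  qed
  have V_Suc: "V (Suc t) \<le> \<rho>\<^sup>2 * V t + K * (real t + 2) ^ Suc d" for t
  proof -
    let ?N = "noise (edges d t) \<theta>"
    have "V (Suc t) = \<rho>\<^sup>2 * V t + ip M ?N ?N"
      unfolding V_def Z_rec
      by (simp add: ip_add_left[OF \<rho>Z noise centered_L2_add[OF \<rho>Z noise]]
          ip_add_right[OF \<rho>Z noise Z_L2] ip_add_right[OF \<rho>Z noise noise]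
          ip_cmult_left ip_cmult_right ip_Z_later_noise ip_commute[of M ?N "Z c t"] power2_eq_square)
    then show ?thesis using noise_var[of t] by linarith
  qed
  \<comment> \<open>The most that step \<open>s\<close> can add to the rescaled variance
    \<open>V t / (\<rho>\<^sup>2) ^ t\<close>: its noise bound divided by
    \<open>(\<rho>\<^sup>2) ^ Suc s\<close>.\<close>
  define b where "b s = K / \<rho>\<^sup>2 * ((real s + 2) ^ Suc d * (1 / \<rho>\<^sup>2) ^ s)" for s
  have "summable b"
    unfolding b_def using \<rho> by (intro summable_mult summable_poly_geometric) auto
  have b0: "0 \<le> b s" for s using B0 by (simp add: b_def K_def)
  define C where "C = V 0 + suminf b"
  have "V t / (\<rho>\<^sup>2) ^ t \<le> V 0 + sum b {..<t}" for t
  proof (induction t)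
    case (Suc t)
    have "V (Suc t) / (\<rho>\<^sup>2) ^ Suc t \<le> (\<rho>\<^sup>2 * V t + K * (real t + 2) ^ Suc d) / (\<rho>\<^sup>2) ^ Suc t"
      using V_Suc[of t] \<rho> by (intro divide_right_mono) auto
    also have "\<dots> = V t / (\<rho>\<^sup>2) ^ t + b t"
      using \<rho> by (simp add: b_def add_divide_distrib power_divide del: power_Suc) (simp add: field_simps)
    also have "\<dots> \<le> V 0 + sum b {..<Suc t}" using Suc.IH by simp
    finally show ?case .
  qed simp
  moreover have "sum b {..<t} \<le> suminf b" for t
    by (rule sum_le_suminf[OF \<open>summable b\<close>]) (auto simp: b0)
  ultimately have V_le: "V t / (\<rho>\<^sup>2) ^ t \<le> C" for t
    unfolding C_def by (meson add_left_mono order_trans)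
  have "0 < C" using V_le[of 0] V_pos[of 0] by simp
  \<comment> \<open>The covariance is \<open>\<rho> ^ t * h 0\<close> and the standard deviation at
    most \<open>sqrt C * \<rho> ^ t\<close>, so the powers cancel.\<close>
  have corr_ge: "h 0 / sqrt C \<le> ip M (Z c t) X0 / sqrt (V t)" for t
  proof -
    have "V t \<le> C * (\<rho> ^ t)\<^sup>2"
      using V_le[of t] \<rho> by (simp add: divide_le_eq power_mult[symmetric] mult.commute)
    then have "sqrt (V t) \<le> sqrt C * \<rho> ^ t"
      using \<rho> \<open>0 < C\<close> real_sqrt_le_mono[of "V t" "C * (\<rho> ^ t)\<^sup>2"] by (simp add: real_sqrt_mult)
    then have "\<rho> ^ t * h 0 / (sqrt C * \<rho> ^ t) \<le> \<rho> ^ t * h 0 / sqrt (V t)"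
      using V_pos[of t] \<open>0 < C\<close> \<rho> h0 by (intro divide_left_mono) auto
    then show ?thesis using \<rho> by (simp add: cov)
  qed
  have "\<not> (\<lambda>t. ip M (Z c t) X0 / sqrt (V t)) \<longlonglongrightarrow> 0"
  proof
    assume "(\<lambda>t. ip M (Z c t) X0 / sqrt (V t)) \<longlonglongrightarrow> 0"
    then have "h 0 / sqrt C \<le> 0" by (rule LIMSEQ_le_const) (use corr_ge in blast)
    then show False using h0(2) \<open>0 < C\<close> by (simp add: divide_le_0_iff)
  qed
  then have "good_coeffs M d \<alpha> X0 W c"
    using V_pos by (simp add: good_coeffs_iff V_def)
  moreover have "0 \<le> c v" for v using h0(1) by (simp add: c_def)
  ultimately show ?thesis by (auto simp: convex_reconstruction_possible_def)
qed

end

theorem mainTheorem1: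
  fixes M :: "'a measure" and d :: nat and \<alpha> :: "nat \<Rightarrow> real"
    and X0 :: "'a \<Rightarrow> real" and W :: "nat list \<times> nat list \<Rightarrow> 'a \<Rightarrow> real"
  assumes model: "gaussian_broadcast M d X0 W"
    and alpha_pos: "\<forall>i\<in>{1..Suc d}. \<alpha> i > 0"
  shows "((\<exists>i\<in>{1..Suc d}. \<alpha> i > 1 / real i) \<longrightarrow> convex_reconstruction_possible M d \<alpha> X0 W)
       \<and> ((\<forall>i\<in>{1..Suc d}. \<alpha> i \<le> 1 / real i) \<longrightarrow> \<not> reconstruction_possible M d \<alpha> X0 W)"
proof -
  interpret prob_space M using model by (simp add: gaussian_broadcast_def)
  interpret broadcast M d \<alpha> X0 W
    by unfold_locales (use model alpha_pos in auto)
  show ?thesis using convex_reconstruction not_reconstruction_possible by blast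
qed

end
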